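(* Let $f\in\mathcal{C}$ and let $\lambda>0$. Then $f$ is semiconjugate via a nondecreasing map $\varphi$ to some map $g\in\mathcal{C}$ of constant slope $\lambda$ if and only if there exists a probability measure $\mu\in\mathcal{M}$ such that $T_f\mu=\lambda\mu$.
   Context: If $P$ is a closed countable subset of $[0,1]$, a connected component of $[0,1]\setminus P$ is called a $P$-basic interval; the set of all of them is $\mathcal{B}(P)$. $\mathcal{C}$ is the class of maps $f$ for which there is a closed countable set $P\subset[0,1]$ such that $f:[0,1]\setminus P\to[0,1]$ and $f$ is continuous and strictly monotone on each $P$-basic interval. Two elements of $\mathcal{C}$ are considered equal if they agree on the complement of a closed countable set; correspondingly, a closed countable set $P$ is called $f$-admissible if $f$ is continuous and strictly monotone on each $P$-basic interval (so different $P$ may be used for the same $f$). A map $f\in\mathcal{C}$ has constant slope $\lambda$ if for some $f$-admissible set $P$ the restriction of $f$ to each $P$-basic interval is affine with slope of absolute value $\lambda$ (this does not depend on the choice of the admissible set $P$). $\mathcal{M}$ is the set of all nonatomic measures $\mu$ on the Borel $\sigma$-algebra of $[0,1]$ that are strongly $\sigma$-finite, i.e. there is a closed countable set $P\subset[0,1]$ such that each $P$-basic interval has finite $\mu$-measure. For $f\in\mathcal{C}$ the operator $T_f:\mathcal{M}\to\mathcal{M}$ is defined by choosing an $f$-admissible set $P$ and setting $(T_f\mu)(A)=\sum_{I\in\mathcal{B}(P)}\mu(f(I\cap A))$ for all Borel sets $A$; it does not depend on the choice of $P$. Semiconjugacy: a continuous nondecreasing surjection $\varphi:[0,1]\to[0,1]$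 semiconjugates $f\in\mathcal{C}$ to $g\in\mathcal{C}$ if there is an $f$-admissible set $P$ such that $\varphi(P)$ is $g$-admissible and, for every $P$-basic interval $I$, the square formed by $f:I\to f(I)$, $\varphi:I\to\varphi(I)$, $\varphi:f(I)\to\varphi(f(I))$ and $g$ on $\varphi(I)$ commutes, that is, there is a continuous map $g_I:\varphi(I)\to[0,1]$ with $\varphi\circ f|_I=g_I\circ\varphi|_I$ and $g_I=g$ on $\varphi(I)\setminus\varphi(P)$. *)

theory Defs
  imports "HOL-Probability.Probability"
begin

definition small_set :: "real set \<Rightarrow> bool" where
  "small_set P \<longleftrightarrow> closed P \<and> countable P \<and> P \<subseteq> {0..1}"

definition basic_intervals :: "real set \<Rightarrow> real set set" where
  "basic_intervals P = components ({0..1} - P)"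

text \<open>
  A map on \<open>[0,1] - P\<close> is represented by a total function whose values on \<open>P\<close> and outside
  \<open>[0,1]\<close> are irrelevant. An element of the class of maps is any function agreeing with such a
  map off some closed countable set. Every notion below depends only on the
  element, not on the chosen function: it is stated through \<^term>\<open>version f P\<close>, the
  representative of \<open>f\<close> that is continuous and strictly monotone on each \<open>P\<close>-basic interval.
\<close>

definition regular_off :: "real set \<Rightarrow> (real \<Rightarrow> real) \<Rightarrow> bool" where
  "regular_off P f \<longleftrightarrow> f ` ({0..1} - P) \<subseteq> {0..1} \<and>
     (\<forall>I \<in> basic_intervals P.
        continuous_on I f \<and> (strict_mono_on I f \<or> strict_antimono_on I f))"

definition same_map :: "(real \<Rightarrow> real) \<Rightarrow> (real \<Rightarrow> real) \<Rightarrow> bool" where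
  "same_map f g \<longleftrightarrow> (\<exists>Q. small_set Q \<and> (\<forall>x \<in> {0..1} - Q. f x = g x))"

definition admissible :: "(real \<Rightarrow> real) \<Rightarrow> real set \<Rightarrow> bool" where
  "admissible f P \<longleftrightarrow> small_set P \<and> (\<exists>f'. same_map f f' \<and> regular_off P f')"

definition version :: "(real \<Rightarrow> real) \<Rightarrow> real set \<Rightarrow> real \<Rightarrow> real" where
  "version f P = (SOME f'. same_map f f' \<and> regular_off P f')"

definition class_C :: "(real \<Rightarrow> real) set" where
  "class_C = {f. \<exists>P. admissible f P}"

definition constant_slope :: "(real \<Rightarrow> real) \<Rightarrow> real \<Rightarrow> bool" where
  "constant_slope f l \<longleftrightarrow> (\<exists>P. admissible f P \<and>
     (\<forall>I \<in> basic_intervals P. \<exists>a b. \<bar>a\<bar> = l \<and> (\<forall>x \<in> I. version f P x = a * x + b)))"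

definition nonatomic :: "'a measure \<Rightarrow> bool" where
  "nonatomic M \<longleftrightarrow> (\<forall>A \<in> sets M. emeasure M A > 0 \<longrightarrow>
     (\<exists>B \<in> sets M. B \<subseteq> A \<and> 0 < emeasure M B \<and> emeasure M B < emeasure M A))"

definition strongly_sigma_finite :: "real measure \<Rightarrow> bool" where
  "strongly_sigma_finite M \<longleftrightarrow>
     (\<exists>P. small_set P \<and> (\<forall>I \<in> basic_intervals P. emeasure M I < \<infinity>))"

definition class_M :: "real measure set" where
  "class_M = {M. sets M = sets (restrict_space borel {0..1}) \<and> nonatomic M
                 \<and> strongly_sigma_finite M}"

definition transfer :: "(real \<Rightarrow> real) \<Rightarrow> real measure \<Rightarrow> real measure" where
  "transfer f M = (let P = (SOME P. admissible f P) in
     measure_of {0..1} (sets (restrict_space borel {0..1}))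
       (\<lambda>A. \<Sum>\<^sub>\<infinity>I\<in>basic_intervals P. emeasure M (version f P ` (I \<inter> A))))"

text \<open>
  The map \<open>h\<close> below is needed because \<open>\<phi> ` I\<close> may contain points of \<open>\<phi> ` P\<close>, where \<open>g\<close> is
  undefined.
\<close>

definition semiconjugates ::
  "(real \<Rightarrow> real) \<Rightarrow> (real \<Rightarrow> real) \<Rightarrow> (real \<Rightarrow> real) \<Rightarrow> bool" where
  "semiconjugates \<phi> f g \<longleftrightarrow>
     continuous_on {0..1} \<phi> \<and> mono_on {0..1} \<phi> \<and> \<phi> ` {0..1} = {0..1} \<and>
     (\<exists>P. admissible f P \<and> admissible g (\<phi> ` P) \<and>
       (\<forall>I \<in> basic_intervals P. \<exists>h.
          continuous_on (\<phi> ` I) h \<and> h ` \<phi> ` I \<subseteq> {0..1} \<and>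
          (\<forall>x \<in> I. \<phi> (version f P x) = h (\<phi> x)) \<and>
          (\<forall>y \<in> \<phi> ` I - \<phi> ` P. h y = version g (\<phi> ` P) y)))"

text \<open>The choice in \<^term>\<open>version\<close> is immaterial on \<open>[0,1] - P\<close>.\<close>

lemma version_props:
  assumes "admissible f P"
  shows "same_map f (version f P)" "regular_off P (version f P)"
  using assms someI_ex[of "\<lambda>f'. same_map f f' \<and> regular_off P f'"]
  unfolding admissible_def version_def by auto

lemma regular_version_unique:
  assumes P: "small_set P" and f: "regular_off P f" and g: "regular_off P g"
    and eq: "same_map f g" and x: "x \<in> {0..1} - P"
  shows "f x = g x"
proof (rule ccontr)
  assume ne: "f x \<noteq> g x"
  obtain Q where Q: "small_set Q" "\<And>y. y \<in> {0..1} - Q \<Longrightarrow> f y = g y"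
    using eq unfolding same_map_def by blast
  have op: "openin (top_of_set {0..1}) ({0..1} - P)"
    using P unfolding small_set_def by (simp add: Diff_eq openin_open_Int open_Compl)
  let ?I = "connected_component_set ({0..1} - P) x"
  have I: "?I \<in> basic_intervals P" and xI: "x \<in> ?I"
    using x unfolding basic_intervals_def components_def by auto
  have "locally connected ({0..1} - P)"
    using locally_open_subset[OF convex_imp_locally_connected[OF convex_real_interval(5)] op] .
  then have "openin (top_of_set ({0..1} - P)) ?I"
    by (simp add: openin_connected_component_locally_connected)
  then have opI: "openin (top_of_set {0..1}) ?I"
    using op openin_trans by blast
  have "continuous_on ?I (\<lambda>y. f y - g y)"
    using I f g unfolding regular_off_def by (intro continuous_intros) auto
  then have "openin (top_of_set ?I) (?I \<inter> (\<lambda>y. f y - g y) -` (- {0}))"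
    by (intro continuous_openin_preimage_gen) auto
  then have "openin (top_of_set {0..1}) (?I \<inter> (\<lambda>y. f y - g y) -` (- {0}))"
    using opI openin_trans by blast
  then obtain T where "open T" and T: "?I \<inter> (\<lambda>y. f y - g y) -` (- {0}) = {0..1} \<inter> T"
    by (auto simp only: openin_open)
  have "x \<in> ?I \<inter> (\<lambda>y. f y - g y) -` (- {0})" using xI ne by simp
  then have "x \<in> T" unfolding T by simp
  then obtain e where e: "e > 0" "ball x e \<subseteq> T"
    using \<open>open T\<close> open_contains_ball by blast
  have TQ: "y \<in> Q" if "y \<in> {0..1}" "y \<in> T" for y
  proof -
    have "y \<in> ?I \<inter> (\<lambda>y. f y - g y) -` (- {0})" unfolding T using that by blast
    then have "f y \<noteq> g y" by simp
    then show ?thesis using Q(2) that(1) by blast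
  qed
  have "{max 0 (x - e)<..<min 1 (x + e)} \<subseteq> Q"
  proof
    fix y assume "y \<in> {max 0 (x - e)<..<min 1 (x + e)}"
    then have y: "0 < y" "x - e < y" "y < 1" "y < x + e" by simp_all
    then have "y \<in> ball x e" by (simp add: dist_real_def abs_less_iff)
    then show "y \<in> Q" using TQ e(2) y by force
  qed
  then have "countable {max 0 (x - e)<..<min 1 (x + e)}"
    using Q(1) countable_subset unfolding small_set_def by blast
  then have "\<not> max 0 (x - e) < min 1 (x + e)"
    using uncountable_open_interval by blast
  then show False using e(1) x by auto
qed

end

theory Submission
  imports Defs
begin

text \<open>
  Given \<open>\<mu>\<close>, its distribution function \<open>\<phi>\<close> is continuous because \<open>\<mu>\<close> has no atoms. The equation
  \<open>T\<^sub>f \<mu> = \<lambda> \<mu>\<close> on an interval \<open>[x,y]\<close> inside a basic interval reads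
  \<open>\<bar>\<phi>(f y) - \<phi>(f x)\<bar> = \<lambda> \<bar>\<phi> y - \<phi> x\<bar>\<close>, so \<open>\<phi> \<circ> f\<close> is an affine function of \<open>\<phi>\<close> with slope
  \<open>\<plusminus>\<lambda>\<close> there, and these affine functions form \<open>g\<close>. Conversely, given \<open>\<phi>\<close>, let \<open>\<mu>\<close> be the
  Stieltjes measure of \<open>\<phi>\<close>. The same increment identity holds locally off a countable set; by
  continuity it holds on whole basic intervals, because a continuous function that is locally
  constant off a countable set has a countable connected image. This gives \<open>T\<^sub>f \<mu> = \<lambda> \<mu>\<close> on
  intervals, hence on Borel sets.
\<close>

section \<open>Basic intervals and change of admissible set\<close>

lemma small_set_Un: "small_set P \<Longrightarrow> small_set Q \<Longrightarrow> small_set (P \<union> Q)"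
  unfolding small_set_def by auto

lemma small_set_endpoints: "small_set {0, 1}"
  unfolding small_set_def by auto

lemma same_map_sym: "same_map f g \<Longrightarrow> same_map g f"
  unfolding same_map_def by metis

lemma same_map_trans:
  assumes "same_map f g" "same_map g h"
  shows "same_map f h"
proof -
  obtain Q R where "small_set Q" "\<forall>x\<in>{0..1} - Q. f x = g x"
    "small_set R" "\<forall>x\<in>{0..1} - R. g x = h x"
    using assms unfolding same_map_def by blast
  then have "small_set (Q \<union> R)" "\<forall>x\<in>{0..1} - (Q \<union> R). f x = h x"
    by (auto intro: small_set_Un)
  then show ?thesis unfolding same_map_def by blast
qed

lemma basic_intervalD:
  assumes "I \<in> basic_intervals P"
  shows "I \<subseteq> {0..1} - P" "is_interval I" "I \<noteq> {}"
  using assms in_components_subset in_components_connected in_components_nonempty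
  unfolding basic_intervals_def is_interval_connected_1 by blast+

lemma Union_basic_intervals: "\<Union>(basic_intervals P) = {0..1} - P"
  unfolding basic_intervals_def by (rule Union_components)

lemma basic_interval_superset:
  assumes "connected S" "S \<noteq> {}" "S \<subseteq> {0..1} - P"
  obtains I where "I \<in> basic_intervals P" "S \<subseteq> I"
proof -
  have "{0..1} - P \<noteq> {}" using assms by blast
  then show ?thesis
    using exists_component_superset[OF assms(3) _ assms(1)] that unfolding basic_intervals_def by blast
qed

lemma disjoint_basic_intervals: "disjoint (basic_intervals P)"
  using pairwise_disjoint_components unfolding basic_intervals_def
  by (auto simp: pairwise_def disjnt_def)

lemma openin_basic_interval:
  assumes "small_set P" "I \<in> basic_intervals P"
  shows "openin (top_of_set {0..1}) I"
proof -
  have op: "openin (top_of_set {0..1}) ({0..1} - P)"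
    using assms unfolding small_set_def by (simp add: Diff_eq openin_open_Int open_Compl)
  have "locally connected ({0..1} - P)"
    using locally_open_subset[OF convex_imp_locally_connected[OF convex_real_interval(5)] op] .
  then have "openin (top_of_set ({0..1} - P)) I"
    using assms(2) openin_components_locally_connected unfolding basic_intervals_def by blast
  then show ?thesis using op openin_trans by blast
qed

text \<open>Basic intervals are disjoint, nonempty and relatively open in [0,1], so each has
  nonempty interior, and disjoint sets with nonempty interior form a countable family.\<close>

lemma countable_basic_intervals:
  assumes "small_set P"
  shows "countable (basic_intervals P)"
proof (rule countable_disjoint_nonempty_interior_subsets)
  show "pairwise disjnt (basic_intervals P)"
    using disjoint_basic_intervals by (auto simp: pairwise_def disjnt_def)
  fix I assume I: "I \<in> basic_intervals P" and int: "interior I = {}"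
  obtain T where T: "open T" "I = {0..1} \<inter> T"
    using openin_basic_interval[OF assms I] by (auto simp: openin_open)
  \<comment> \<open>\<open>I\<close> is open only relative to [0,1], so interior points are sought
    in (0,1). An open set that misses (0,1) also misses its closure [0,1].\<close>
  have "T \<inter> {0<..<1} \<subseteq> interior I"
    using T by (intro interior_maximal) auto
  then have "T \<inter> {0<..<1} = {}" using int by simp
  then have "T \<inter> closure {0<..<1} = {}" using T(1) open_Int_closure_eq_empty by blast
  then show "I = {}" using T(2) by auto
qed

text \<open>Removing more points only cuts basic intervals into smaller ones. This makes
  representatives belonging to different admissible sets comparable off the union of the two
  sets.\<close>

lemma regular_off_mono:
  assumes "regular_off P f" "P \<subseteq> Q"
  shows "regular_off Q f"
  unfolding regular_off_def
proof (intro conjI ballI)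
  show "f ` ({0..1} - Q) \<subseteq> {0..1}" using assms unfolding regular_off_def by blast
  fix I assume I: "I \<in> basic_intervals Q"
  have "connected I" "I \<noteq> {}" "I \<subseteq> {0..1} - P"
    using basic_intervalD[OF I] assms(2) by (auto simp: is_interval_connected_1)
  then obtain K where K: "K \<in> basic_intervals P" "I \<subseteq> K"
    by (rule basic_interval_superset)
  show "continuous_on I f"
    using assms(1) K continuous_on_subset unfolding regular_off_def by blast
  show "strict_mono_on I f \<or> strict_antimono_on I f"
    using assms(1) K monotone_on_subset unfolding regular_off_def by blast
qed

text \<open>\<open>regular_version_unique\<close> compares representatives that are regular off one
  common set, so both are first viewed off \<open>P \<union> Q\<close>.\<close>

lemma version_eq:
  assumes "admissible f P" "admissible f Q" "x \<in> {0..1} - (P \<union> Q)"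
  shows "version f P x = version f Q x"
proof (rule regular_version_unique[of "P \<union> Q" "version f P" "version f Q"])
  show "small_set (P \<union> Q)"
    using assms small_set_Un unfolding admissible_def by blast
  show "regular_off (P \<union> Q) (version f P)" "regular_off (P \<union> Q) (version f Q)"
    using assms(1,2) version_props(2) regular_off_mono by (metis Un_upper1 Un_upper2)+
  show "same_map (version f P) (version f Q)"
    using assms(1,2) version_props(1) same_map_sym same_map_trans by blast
  show "x \<in> {0..1} - (P \<union> Q)" by fact
qed

section \<open>Extending increment identities across countable sets\<close>

text \<open>A value taken off \<open>C\<close> is also taken at a nearby rational, so the image of a
  compact subinterval lies in the countable set \<open>F\<close> applied to
  \<open>C \<union> \<rat>\<close>. That image is connected, and a countable connected set of reals
  has at most one point.\<close>

lemma constant_if_locally_constant_off_countable: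
  fixes F :: "real \<Rightarrow> real"
  assumes J: "is_interval J" and cont: "continuous_on J F" and C: "countable C"
    and loc: "\<And>y. y \<in> J - C \<Longrightarrow> \<exists>e>0. \<forall>z\<in>J. \<bar>z - y\<bar> < e \<longrightarrow> F z = F y"
    and xy: "x \<in> J" "y \<in> J"
  shows "F x = F y"
proof -
  have main: "F a = F b" if ab: "a \<in> J" "b \<in> J" "a < b" for a b
  proof (rule ccontr)
    assume ne: "F a \<noteq> F b"
    have sub: "{a..b} \<subseteq> J"
      using J ab unfolding is_interval_1 by (meson atLeastAtMost_iff subsetI)
    have "F ` {a..b} \<subseteq> F ` (C \<union> \<rat>)"
    proof
      fix v assume "v \<in> F ` {a..b}"
      then obtain y where y: "y \<in> {a..b}" "v = F y" by blast
      show "v \<in> F ` (C \<union> \<rat>)"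
      proof (cases "y \<in> C")
        case False
        then obtain e where e: "e > 0" "\<And>z. z \<in> J \<Longrightarrow> \<bar>z - y\<bar> < e \<Longrightarrow> F z = F y"
          using loc y sub by blast
        \<comment> \<open>Cutting the neighbourhood down to [a,b] keeps the rational inside even
          when \<open>y\<close> is an endpoint.\<close>
        have "max a (y - e) < min b (y + e)" using e(1) y ab by auto
        then obtain q where q: "q \<in> \<rat>" "max a (y - e) < q" "q < min b (y + e)"
          using Rats_dense_in_real by blast
        then have "q \<in> {a..b}" by auto
        then have "F q = F y" using q sub by (intro e(2)) auto
        then show ?thesis using q y by (metis UnI2 image_eqI)
      qed (use y in blast)
    qed
    then have "countable (F ` {a..b})"
      using C countable_rat by (meson countable_Un countable_image countable_subset)
    moreover have "connected (F ` {a..b})"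
      using continuous_on_subset[OF cont sub] by (intro connected_continuous_image) auto
    ultimately show False
      using connected_uncountable[of "F ` {a..b}" "F a" "F b"] ne ab by auto
  qed
  show ?thesis using main[OF xy] main[OF xy(2,1)] by (metis linorder_neqE_linordered_idom)
qed

lemma increment_ratio_extends_mono:
  fixes \<phi> h :: "real \<Rightarrow> real"
  assumes J: "is_interval J" and cont: "continuous_on J \<phi>" "continuous_on J h"
    and mono: "mono_on J \<phi>" "mono_on J h" and C: "countable C" and l: "l \<ge> 0"
    and loc: "\<And>y. y \<in> J - C \<Longrightarrow>
       \<exists>e>0. \<forall>z\<in>J. \<bar>z - y\<bar> < e \<longrightarrow> \<bar>h z - h y\<bar> = l * \<bar>\<phi> z - \<phi> y\<bar>"
    and yz: "y \<in> J" "z \<in> J"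
  shows "h z - h y = l * (\<phi> z - \<phi> y)"
proof -
  have "h z - l * \<phi> z = h y - l * \<phi> y"
  proof (rule constant_if_locally_constant_off_countable[OF J _ C, of "\<lambda>x. h x - l * \<phi> x"])
    show "continuous_on J (\<lambda>x. h x - l * \<phi> x)" by (intro continuous_intros cont)
    fix y assume y: "y \<in> J - C"
    then obtain e where e: "e > 0"
      "\<And>z. z \<in> J \<Longrightarrow> \<bar>z - y\<bar> < e \<Longrightarrow> \<bar>h z - h y\<bar> = l * \<bar>\<phi> z - \<phi> y\<bar>"
      using loc by blast
    have "h z - l * \<phi> z = h y - l * \<phi> y" if z: "z \<in> J" "\<bar>z - y\<bar> < e" for z
    proof (cases "z \<le> y")
      case True
      then have "h z \<le> h y" "\<phi> z \<le> \<phi> y" using mono y z by (auto simp: mono_on_def)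
      then show ?thesis using e(2)[OF z] by (simp add: abs_if algebra_simps split: if_splits)
    next
      case False
      then have "h y \<le> h z" "\<phi> y \<le> \<phi> z" using mono y z by (auto simp: mono_on_def)
      then show ?thesis using e(2)[OF z] by (simp add: abs_if algebra_simps split: if_splits)
    qed
    then show "\<exists>e>0. \<forall>z\<in>J. \<bar>z - y\<bar> < e \<longrightarrow> h z - l * \<phi> z = h y - l * \<phi> y"
      using e(1) by blast
  qed (use yz in auto)
  then show ?thesis by (simp add: algebra_simps)
qed

text \<open>The decreasing case is the increasing one applied to \<open>- h\<close>.\<close>

lemma increment_ratio_extends:
  fixes \<phi> h :: "real \<Rightarrow> real"
  assumes J: "is_interval J" and cont: "continuous_on J \<phi>" "continuous_on J h"
    and mono: "mono_on J \<phi>" "mono_on J h \<or> antimono_on J h" and C: "countable C" and l: "l \<ge> 0"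
    and loc: "\<And>y. y \<in> J - C \<Longrightarrow>
       \<exists>e>0. \<forall>z\<in>J. \<bar>z - y\<bar> < e \<longrightarrow> \<bar>h z - h y\<bar> = l * \<bar>\<phi> z - \<phi> y\<bar>"
    and yz: "y \<in> J" "z \<in> J"
  shows "\<bar>h z - h y\<bar> = l * \<bar>\<phi> z - \<phi> y\<bar>"
  using mono(2)
proof
  assume "mono_on J h"
  then show ?thesis
    using increment_ratio_extends_mono[OF J cont mono(1) _ C l loc yz] l by (simp add: abs_mult)
next
  assume anti: "antimono_on J h"
  have "- h z - (- h y) = l * (\<phi> z - \<phi> y)"
  proof (rule increment_ratio_extends_mono[OF J cont(1) _ mono(1) _ C l _ yz])
    show "continuous_on J (\<lambda>x. - h x)" by (intro continuous_intros cont)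
    show "mono_on J (\<lambda>x. - h x)" using anti by (auto simp: monotone_on_def)
    show "\<exists>e>0. \<forall>z\<in>J. \<bar>z - y\<bar> < e \<longrightarrow> \<bar>- h z - - h y\<bar> = l * \<bar>\<phi> z - \<phi> y\<bar>" if "y \<in> J - C" for y
      using loc[OF that] by (simp add: abs_minus_commute)
  qed
  then have "h z - h y = - (l * (\<phi> z - \<phi> y))" by simp
  then show ?thesis using l by (simp add: abs_mult)
qed

section \<open>Increments under a semiconjugacy to a map of constant slope\<close>

lemma small_set_nbhd:
  assumes "small_set P" "y \<in> {0<..<1} - P"
  obtains e where "e > 0" "{y - e<..<y + e} \<subseteq> {0..1} - P"
proof -
  have "open ({0<..<1} - P)" using assms unfolding small_set_def by (intro open_Diff) auto
  then obtain e where "e > 0" "ball y e \<subseteq> {0<..<1} - P"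
    using assms(2) open_contains_ball by blast
  moreover have "{0<..<1} - P \<subseteq> {0..1} - P" by auto
  ultimately have "{y - e<..<y + e} \<subseteq> {0..1} - P"
    unfolding ball_eq_greaterThanLessThan by (meson subset_trans)
  with \<open>e > 0\<close> show ?thesis by (rule that)
qed

text \<open>The admissible set that witnesses constant slope may differ from \<open>R\<close>. Away
  from both, the two representatives of \<open>g\<close> agree, so the slope identity holds locally
  for the one belonging to \<open>R\<close>.\<close>

lemma constant_slope_local:
  assumes "constant_slope g l" "admissible g R"
  obtains C where "small_set C"
    "\<And>y. y \<in> {0..1} - C \<Longrightarrow>
       \<exists>e>0. \<forall>z. \<bar>z - y\<bar> < e \<longrightarrow> z \<notin> R \<and> \<bar>version g R z - version g R y\<bar> = l * \<bar>z - y\<bar>"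
proof -
  obtain P where P: "admissible g P"
    and aff: "\<And>I. I \<in> basic_intervals P \<Longrightarrow>
      \<exists>a b. \<bar>a\<bar> = l \<and> (\<forall>x\<in>I. version g P x = a * x + b)"
    using assms(1) unfolding constant_slope_def by blast
  \<comment> \<open>The endpoints are included so that every remaining point has a full two-sided
    neighbourhood inside [0,1].\<close>
  define C where "C = P \<union> R \<union> {0, 1}"
  have C: "small_set C"
    using P assms(2) small_set_Un small_set_endpoints unfolding C_def admissible_def by blast
  moreover have "\<exists>e>0. \<forall>z. \<bar>z - y\<bar> < e \<longrightarrow> z \<notin> R \<and> \<bar>version g R z - version g R y\<bar> = l * \<bar>z - y\<bar>"
    if y: "y \<in> {0..1} - C" for y
  proof -
    have "y \<in> {0<..<1} - C" using y unfolding C_def by auto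
    then obtain e where e: "e > 0" "{y - e<..<y + e} \<subseteq> {0..1} - C"
      using small_set_nbhd[OF C] by blast
    then have "{y - e<..<y + e} \<subseteq> {0..1} - P" "{y - e<..<y + e} \<noteq> {}"
      unfolding C_def by auto
    then obtain I where I: "I \<in> basic_intervals P" "{y - e<..<y + e} \<subseteq> I"
      using basic_interval_superset[of "{y - e<..<y + e}" P] by auto
    obtain a b where ab: "\<bar>a\<bar> = l" "\<And>x. x \<in> I \<Longrightarrow> version g P x = a * x + b"
      using aff[OF I(1)] by blast
    have eq: "version g R z = a * z + b \<and> z \<notin> R" if "z \<in> {y - e<..<y + e}" for z
    proof -
      have "z \<in> {0..1} - (R \<union> P)" using e(2) that unfolding C_def by blast
      then show ?thesis using version_eq[OF assms(2) P] ab(2) I(2) that by auto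
    qed
    have "z \<notin> R \<and> \<bar>version g R z - version g R y\<bar> = l * \<bar>z - y\<bar>" if "\<bar>z - y\<bar> < e" for z
    proof -
      have "z \<in> {y - e<..<y + e}" "y \<in> {y - e<..<y + e}" using that e(1) by auto
      then have "version g R z - version g R y = a * (z - y)" "z \<notin> R"
        using eq by (auto simp: algebra_simps)
      then show ?thesis using ab(1) by (simp add: abs_mult)
    qed
    then show ?thesis using e(1) by blast
  qed
  ultimately show ?thesis by (rule that)
qed

text \<open>Points \<open>u \<le> v\<close> of the image have preimages in the same order, so the
  direction of \<open>f\<close> on \<open>K\<close> passes to \<open>h\<close>.\<close>

lemma monotone_on_semiconjugate_image:
  fixes \<phi> :: "real \<Rightarrow> real"
  assumes \<phi>: "mono_on {0..1} \<phi>" and K: "K \<subseteq> {0..1}" and f: "f ` K \<subseteq> {0..1}"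
    and mon: "strict_mono_on K f \<or> strict_antimono_on K f"
    and comm: "\<And>x. x \<in> K \<Longrightarrow> \<phi> (f x) = h (\<phi> x)"
  shows "mono_on (\<phi> ` K) h \<or> antimono_on (\<phi> ` K) h"
proof -
  have *: "\<exists>x y. x \<in> K \<and> y \<in> K \<and> x \<le> y \<and> \<phi> x = u \<and> \<phi> y = v"
    if uv: "u \<in> \<phi> ` K" "v \<in> \<phi> ` K" "u \<le> v" for u v
  proof -
    obtain x y where xy: "x \<in> K" "y \<in> K" "\<phi> x = u" "\<phi> y = v" using uv by blast
    show ?thesis
    proof (cases "x \<le> y")
      case False
      \<comment> \<open>Preimages in the wrong order force \<open>u = v\<close>, and then a single
        preimage serves for both.\<close>
      then have "\<phi> y \<le> \<phi> x" using xy K by (intro mono_onD[OF \<phi>]) auto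
      then show ?thesis using xy uv(3) by auto
    qed (use xy in blast)
  qed
  show ?thesis
    using mon
  proof
    assume m: "strict_mono_on K f"
    have "h u \<le> h v" if uv: "u \<in> \<phi> ` K" "v \<in> \<phi> ` K" "u \<le> v" for u v
    proof -
      obtain x y where xy: "x \<in> K" "y \<in> K" "x \<le> y" "\<phi> x = u" "\<phi> y = v"
        using *[OF uv] by blast
      then have "f x \<le> f y" using m by (metis monotone_on_def order_le_less)
      then have "\<phi> (f x) \<le> \<phi> (f y)" using \<phi> f xy unfolding mono_on_def by blast
      then show ?thesis using comm xy by auto
    qed
    then show ?thesis by (simp add: monotone_on_def)
  next
    assume m: "strict_antimono_on K f"
    have "h v \<le> h u" if uv: "u \<in> \<phi> ` K" "v \<in> \<phi> ` K" "u \<le> v" for u v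
    proof -
      obtain x y where xy: "x \<in> K" "y \<in> K" "x \<le> y" "\<phi> x = u" "\<phi> y = v"
        using *[OF uv] by blast
      then have "f y \<le> f x" using m by (metis monotone_on_def order_le_less)
      then have "\<phi> (f y) \<le> \<phi> (f x)" using \<phi> f xy unfolding mono_on_def by blast
      then show ?thesis using comm xy by auto
    qed
    then show ?thesis by (simp add: monotone_on_def)
  qed
qed

text \<open>The operator \<open>transfer\<close> picks its own admissible set, unrelated to the set
  \<open>P\<close> in the semiconjugacy, so the identity is needed for every \<open>Q\<close>. It is
  obtained by extending across countable sets twice: first in the target, for the factor map
  \<open>h\<close> on the image of a \<open>P\<close>-basic interval, then in the source, on a
  \<open>Q\<close>-basic interval.\<close>

lemma semiconjugate_increment:
  assumes semi: "semiconjugates \<phi> f g" and slope: "constant_slope g l" and l: "l \<ge> 0"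
    and Q: "admissible f Q" and I: "I \<in> basic_intervals Q" and xy: "x \<in> I" "y \<in> I"
  shows "\<bar>\<phi> (version f Q y) - \<phi> (version f Q x)\<bar> = l * \<bar>\<phi> y - \<phi> x\<bar>"
proof -
  have \<phi>: "continuous_on {0..1} \<phi>" "mono_on {0..1} \<phi>" "\<phi> ` {0..1} = {0..1}"
    using semi unfolding semiconjugates_def by auto
  obtain P where P: "admissible f P" "admissible g (\<phi> ` P)"
    and H: "\<And>I. I \<in> basic_intervals P \<Longrightarrow> \<exists>h.
          continuous_on (\<phi> ` I) h \<and> h ` \<phi> ` I \<subseteq> {0..1} \<and>
          (\<forall>x \<in> I. \<phi> (version f P x) = h (\<phi> x)) \<and>
          (\<forall>y \<in> \<phi> ` I - \<phi> ` P. h y = version g (\<phi> ` P) y)"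
    using semi unfolding semiconjugates_def by blast
  have reg: "version f R ` K \<subseteq> {0..1}" "continuous_on K (version f R)"
    "strict_mono_on K (version f R) \<or> strict_antimono_on K (version f R)" "K \<subseteq> {0..1}"
    if "admissible f R" "K \<in> basic_intervals R" for R K
  proof -
    have R: "regular_off R (version f R)" and K: "K \<subseteq> {0..1} - R"
      using version_props(2)[OF that(1)] basic_intervalD(1)[OF that(2)] by auto
    show "version f R ` K \<subseteq> {0..1}" using R K unfolding regular_off_def by blast
    show "continuous_on K (version f R)"
      using R that(2) unfolding regular_off_def by blast
    show "strict_mono_on K (version f R) \<or> strict_antimono_on K (version f R)"
      using R that(2) unfolding regular_off_def by blast
    show "K \<subseteq> {0..1}" using K by blast
  qed
  obtain C where C: "small_set C"
    "\<And>y. y \<in> {0..1} - C \<Longrightarrow> \<exists>e>0. \<forall>z. \<bar>z - y\<bar> < e \<longrightarrow> z \<notin> \<phi> ` P \<and>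
       \<bar>version g (\<phi> ` P) z - version g (\<phi> ` P) y\<bar> = l * \<bar>z - y\<bar>"
    using constant_slope_local[OF slope P(2)] by blast
  have step: "\<bar>\<phi> (version f P y) - \<phi> (version f P x)\<bar> = l * \<bar>\<phi> y - \<phi> x\<bar>"
    if K: "K \<in> basic_intervals P" and xy: "x \<in> K" "y \<in> K" for K x y
  proof -
    obtain h where h: "continuous_on (\<phi> ` K) h" "\<And>x. x \<in> K \<Longrightarrow> \<phi> (version f P x) = h (\<phi> x)"
      "\<And>y. y \<in> \<phi> ` K - \<phi> ` P \<Longrightarrow> h y = version g (\<phi> ` P) y"
      using H[OF K] by metis
    note r = reg[OF P(1) K]
    have sub: "\<phi> ` K \<subseteq> {0..1}" using \<phi>(3) r(4) by blast
    have "\<bar>h (\<phi> y) - h (\<phi> x)\<bar> = l * \<bar>\<phi> y - \<phi> x\<bar>"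
    \<comment> \<open>The extension is made on the image, with the identity in the role of
      \<open>\<phi>\<close>, because the preimage of the countable set \<open>C\<close> may be
      uncountable: \<open>\<phi>\<close> can be constant on intervals.\<close>
    proof (rule increment_ratio_extends[where J = "\<phi> ` K" and C = C and \<phi> = "\<lambda>x. x" and l = l])
      show "is_interval (\<phi> ` K)"
        using basic_intervalD(2)[OF K] continuous_on_subset[OF \<phi>(1) r(4)]
        by (simp add: is_interval_connected_1 connected_continuous_image)
      show "mono_on (\<phi> ` K) h \<or> antimono_on (\<phi> ` K) h"
        by (rule monotone_on_semiconjugate_image[OF \<phi>(2) r(4,1,3) h(2)])
      show "countable C" using C(1) unfolding small_set_def by blast
      fix v assume v: "v \<in> \<phi> ` K - C"
      then obtain e where e: "e > 0" "\<And>z. \<bar>z - v\<bar> < e \<Longrightarrow> z \<notin> \<phi> ` P \<and>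
          \<bar>version g (\<phi> ` P) z - version g (\<phi> ` P) v\<bar> = l * \<bar>z - v\<bar>"
        using C(2)[of v] sub by blast
      have "\<bar>h z - h v\<bar> = l * \<bar>z - v\<bar>" if "z \<in> \<phi> ` K" "\<bar>z - v\<bar> < e" for z
        using e(2)[of z] e(2)[of v] e(1) h(3)[of z] h(3)[of v] v that by auto
      then show "\<exists>e>0. \<forall>z\<in>\<phi> ` K. \<bar>z - v\<bar> < e \<longrightarrow> \<bar>h z - h v\<bar> = l * \<bar>z - v\<bar>"
        using e(1) by blast
    qed (use h l xy in \<open>auto simp: monotone_on_def\<close>)
    then show ?thesis using h(2) xy by simp
  qed
  note r = reg[OF Q I]
  \<comment> \<open>Near a point off \<open>E\<close> the representatives for \<open>P\<close> and
    \<open>Q\<close> coincide and the neighbourhood lies in one \<open>P\<close>-basic interval, so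
    \<open>step\<close> applies there.\<close>
  define E where "E = P \<union> Q \<union> {0, 1}"
  have E: "small_set E"
    using P Q small_set_Un small_set_endpoints unfolding E_def admissible_def by blast
  show ?thesis
  proof (rule increment_ratio_extends[where J = I and C = E and \<phi> = \<phi> and l = l
        and h = "\<lambda>x. \<phi> (version f Q x)"])
    show "is_interval I" using basic_intervalD[OF I] by blast
    show "continuous_on I \<phi>" using \<phi>(1) r(4) continuous_on_subset by blast
    show "continuous_on I (\<lambda>x. \<phi> (version f Q x))"
      using continuous_on_compose2[OF \<phi>(1) r(2,1)] .
    show "mono_on I \<phi>" using \<phi>(2) r(4) monotone_on_subset by blast
    show "mono_on I (\<lambda>x. \<phi> (version f Q x)) \<or> antimono_on I (\<lambda>x. \<phi> (version f Q x))"
      using r(3)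
    proof
      assume m: "strict_mono_on I (version f Q)"
      have "\<phi> (version f Q x) \<le> \<phi> (version f Q y)" if "x \<in> I" "y \<in> I" "x \<le> y" for x y
        using m that r(1) \<phi>(2) unfolding monotone_on_def
        by (smt (verit) image_subset_iff)
      then show ?thesis by (simp add: monotone_on_def)
    next
      assume m: "strict_antimono_on I (version f Q)"
      have "\<phi> (version f Q x) \<ge> \<phi> (version f Q y)" if "x \<in> I" "y \<in> I" "x \<le> y" for x y
        using m that r(1) \<phi>(2) unfolding monotone_on_def
        by (smt (verit) image_subset_iff)
      then show ?thesis by (simp add: monotone_on_def)
    qed
    show "countable E" using E unfolding small_set_def by blast
    fix v assume v: "v \<in> I - E"
    then have "v \<in> {0<..<1} - E" using r(4) unfolding E_def by force
    then obtain e where e: "e > 0" "{v - e<..<v + e} \<subseteq> {0..1} - E"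
      using small_set_nbhd[OF E] by blast
    then have "{v - e<..<v + e} \<subseteq> {0..1} - P" "{v - e<..<v + e} \<noteq> {}"
      unfolding E_def by auto
    then obtain K where K: "K \<in> basic_intervals P" "{v - e<..<v + e} \<subseteq> K"
      using basic_interval_superset[of "{v - e<..<v + e}" P] by auto
    have "\<bar>\<phi> (version f Q z) - \<phi> (version f Q v)\<bar> = l * \<bar>\<phi> z - \<phi> v\<bar>" if "\<bar>z - v\<bar> < e" for z
    proof -
      have zv: "z \<in> {v - e<..<v + e}" "v \<in> {v - e<..<v + e}" using that e(1) by auto
      then have "z \<in> {0..1} - (Q \<union> P)" "v \<in> {0..1} - (Q \<union> P)"
        using e(2) unfolding E_def by blast+
      then have "version f Q z = version f P z" "version f Q v = version f P v"
        using version_eq[OF Q P(1)] by blast+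
      moreover have "z \<in> K" "v \<in> K" using K(2) zv by blast+
      ultimately show ?thesis using step[OF K(1), of v z] by simp
    qed
    then show "\<exists>e>0. \<forall>z\<in>I. \<bar>z - v\<bar> < e \<longrightarrow>
        \<bar>\<phi> (version f Q z) - \<phi> (version f Q v)\<bar> = l * \<bar>\<phi> z - \<phi> v\<bar>"
      using e(1) by blast
  qed (use l xy in auto)
qed

section \<open>Measures of images of Borel sets under monotone maps\<close>

text \<open>The endpoints come from a countable subset \<open>D\<close> of \<open>S\<close> that has
  elements below and above every point of \<open>S\<close>. Running minima and maxima of an
  enumeration of \<open>D\<close> make the compact intervals increase.\<close>

lemma interval_exhaustion:
  fixes S :: "real set"
  assumes S: "is_interval S" "S \<noteq> {}"
  obtains c d :: "nat \<Rightarrow> real" where "range c \<subseteq> S" "range d \<subseteq> S"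
    "incseq (\<lambda>n. {c n..d n})" "S = (\<Union>n. {c n..d n})"
proof -
  \<comment> \<open>\<open>Inf S\<close> and \<open>Sup S\<close> are added because an endpoint
    belonging to \<open>S\<close> may be irrational. Intersecting with \<open>S\<close> discards
    them when they lie outside.\<close>
  define D where "D = S \<inter> (\<rat> \<union> {Inf S, Sup S})"
  have cD: "countable D" unfolding D_def by (simp add: countable_rat)
  have lower: "\<exists>c\<in>D. c \<le> y" if y: "y \<in> S" for y
  proof (cases "\<exists>s\<in>S. s < y")
    case True
    then obtain s q where q: "s \<in> S" "s < q" "q < y" "q \<in> \<rat>"
      using Rats_dense_in_real by blast
    then have "q \<in> S" using S(1) y unfolding is_interval_1 by (meson less_imp_le)
    then have "q \<in> D" using q(4) unfolding D_def by blast
    then show ?thesis using q by (meson less_imp_le)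
  next
    case False
    then have "Inf S = y" using y by (intro cInf_eq_minimum) (auto simp: not_less)
    then show ?thesis using y unfolding D_def by auto
  qed
  have upper: "\<exists>d\<in>D. y \<le> d" if y: "y \<in> S" for y
  proof (cases "\<exists>s\<in>S. y < s")
    case True
    then obtain s q where q: "s \<in> S" "y < q" "q < s" "q \<in> \<rat>"
      using Rats_dense_in_real by blast
    then have "q \<in> S" using S(1) y unfolding is_interval_1 by (meson less_imp_le)
    then have "q \<in> D" using q(4) unfolding D_def by blast
    then show ?thesis using q by (meson less_imp_le)
  next
    case False
    then have "Sup S = y" using y by (intro cSup_eq_maximum) (auto simp: not_less)
    then show ?thesis using y unfolding D_def by auto
  qed
  have D0: "D \<noteq> {}" using lower S(2) by blast
  define e where "e = from_nat_into D"
  have eD: "e n \<in> D" for n unfolding e_def using from_nat_into[OF D0] .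
  have rng: "range e = D" unfolding e_def using range_from_nat_into[OF D0 cD] .
  define c where "c n = Min (e ` {..n})" for n
  define d where "d n = Max (e ` {..n})" for n
  have cS: "c n \<in> S" for n
  proof -
    have "c n \<in> e ` {..n}" unfolding c_def by (intro Min_in) auto
    then show ?thesis using eD unfolding D_def by auto
  qed
  have dS: "d n \<in> S" for n
  proof -
    have "d n \<in> e ` {..n}" unfolding d_def by (intro Max_in) auto
    then show ?thesis using eD unfolding D_def by auto
  qed
  have "incseq (\<lambda>n. {c n..d n})"
  proof (rule incseq_SucI)
    fix n
    have "c (Suc n) \<le> c n" unfolding c_def by (intro Min_antimono) auto
    moreover have "d n \<le> d (Suc n)" unfolding d_def by (intro Max_mono) auto
    ultimately show "{c n..d n} \<subseteq> {c (Suc n)..d (Suc n)}" by auto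
  qed
  moreover have "S = (\<Union>n. {c n..d n})"
  proof
    show "S \<subseteq> (\<Union>n. {c n..d n})"
    proof
      fix y assume y: "y \<in> S"
      obtain i j where "e i \<le> y" "y \<le> e j" using lower[OF y] upper[OF y] rng by auto
      moreover have "c (max i j) \<le> e i" unfolding c_def by (intro Min_le) auto
      moreover have "e j \<le> d (max i j)" unfolding d_def by (intro Max_ge) auto
      ultimately have "y \<in> {c (max i j)..d (max i j)}" by auto
      then show "y \<in> (\<Union>n. {c n..d n})" by blast
    qed
    show "(\<Union>n. {c n..d n}) \<subseteq> S"
    proof
      fix y assume "y \<in> (\<Union>n. {c n..d n})"
      then obtain n where "c n \<le> y" "y \<le> d n" by auto
      then show "y \<in> S" using S(1) cS dS unfolding is_interval_1 by blast
    qed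
  qed
  moreover have "range c \<subseteq> S" "range d \<subseteq> S" using cS dS by auto
  ultimately show ?thesis using that by blast
qed

text \<open>Continuity from below along the exhaustion carries equality from compact intervals to
  open and half-open ones.\<close>

lemma emeasure_interval_cong:
  fixes M N :: "real measure"
  assumes sets: "sets M = sets borel" "sets N = sets borel" and S: "is_interval S"
    and eq: "\<And>x y. x \<in> S \<Longrightarrow> y \<in> S \<Longrightarrow> x \<le> y \<Longrightarrow> emeasure M {x..y} = emeasure N {x..y}"
  shows "emeasure M S = emeasure N S"
proof (cases "S = {}")
  case False
  obtain c d :: "nat \<Rightarrow> real" where cd: "range c \<subseteq> S" "range d \<subseteq> S"
    "incseq (\<lambda>n. {c n..d n})" "S = (\<Union>n. {c n..d n})"
    by (rule interval_exhaustion[OF S False])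
  have rng: "range (\<lambda>n. {c n..d n}) \<subseteq> sets M" "range (\<lambda>n. {c n..d n}) \<subseteq> sets N"
    by (simp_all add: sets image_subset_iff)
  have "emeasure M S = (SUP n. emeasure M {c n..d n})"
    using SUP_emeasure_incseq[OF rng(1) cd(3)] cd(4) by simp
  also have "\<dots> = (SUP n. emeasure N {c n..d n})"
  proof (rule SUP_cong)
    fix n show "emeasure M {c n..d n} = emeasure N {c n..d n}"
      using eq[of "c n" "d n"] cd(1,2) by (cases "c n \<le> d n") (auto simp: image_subset_iff)
  qed simp
  also have "\<dots> = emeasure N S"
    using SUP_emeasure_incseq[OF rng(2) cd(3)] cd(4) by simp
  finally show ?thesis .
qed simp

text \<open>The inverse is monotone on the image and so Borel; if \<open>f\<close> is decreasing,
  this is applied to the negated inverse.\<close>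

lemma strict_monotone_the_inv_into:
  fixes f :: "real \<Rightarrow> real"
  assumes "strict_mono_on I f \<or> strict_antimono_on I f"
  shows "inj_on f I" "the_inv_into I f \<in> borel_measurable (restrict_space borel (f ` I))"
proof -
  show inj: "inj_on f I"
    using assms unfolding inj_on_def monotone_on_def by (metis linorder_neqE_linordered_idom order_less_irrefl)
  let ?k = "the_inv_into I f"
  have k: "?k (f x) = x" if "x \<in> I" for x using the_inv_into_f_f[OF inj that] .
  from assms show "?k \<in> borel_measurable (restrict_space borel (f ` I))"
  proof
    assume m: "strict_mono_on I f"
    have "mono_on (f ` I) ?k"
      unfolding mono_on_def
    proof (clarify, unfold k)
      fix x y assume "x \<in> I" "y \<in> I" "f x \<le> f y"
      then show "x \<le> y" using m unfolding monotone_on_def by (meson leD leI)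
    qed
    then show ?thesis by (rule borel_measurable_mono_on_fnc)
  next
    assume m: "strict_antimono_on I f"
    have "mono_on (f ` I) (\<lambda>z. - ?k z)"
      unfolding mono_on_def
    proof (clarify, unfold k)
      fix x y assume "x \<in> I" "y \<in> I" "f x \<le> f y"
      then have "y \<le> x" using m unfolding monotone_on_def by (meson leD leI)
      then show "- x \<le> - y" by simp
    qed
    then have "(\<lambda>z. - (- ?k z)) \<in> borel_measurable (restrict_space borel (f ` I))"
      by (intro borel_measurable_uminus borel_measurable_mono_on_fnc)
    then show ?thesis by simp
  qed
qed

text \<open>Both sides are measures in \<open>A\<close>: \<open>N\<close> is the pushforward under
  the inverse of \<open>f\<close> of \<open>M\<close> restricted to the image of \<open>I\<close>,
  and \<open>R\<close> is \<open>l\<close> times the restriction of \<open>M\<close> to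
  \<open>I\<close>. They agree on compact intervals, an intersection-stable generator of the Borel
  sets.\<close>

lemma emeasure_image_scale:
  fixes f :: "real \<Rightarrow> real"
  assumes M: "finite_measure M" "sets M = sets borel" and I: "is_interval I"
    and cont: "continuous_on I f" and mon: "strict_mono_on I f \<or> strict_antimono_on I f"
    and eq: "\<And>x y. x \<in> I \<Longrightarrow> y \<in> I \<Longrightarrow> x \<le> y \<Longrightarrow>
      emeasure M (f ` {x..y}) = ennreal l * emeasure M {x..y}"
    and A: "A \<in> sets borel"
  shows "emeasure M (f ` (I \<inter> A)) = ennreal l * emeasure M (I \<inter> A)"
proof -
  interpret finite_measure M by fact
  have sp: "space M = UNIV" using sets_eq_imp_space_eq[OF M(2)] by simp
  let ?k = "the_inv_into I f"
  note inj = strict_monotone_the_inv_into(1)[OF mon]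
  have "is_interval (f ` I)"
    using I cont by (simp add: is_interval_connected_1 connected_continuous_image)
  then have fI: "f ` I \<in> sets borel" by (rule real_interval_borel_measurable)
  have I': "I \<in> sets borel" using I by (rule real_interval_borel_measurable)
  have "sets (restrict_space M (f ` I)) = sets (restrict_space borel (f ` I))"
    using M(2) by (rule sets_restrict_space_cong)
  then have k: "?k \<in> restrict_space M (f ` I) \<rightarrow>\<^sub>M borel"
    using strict_monotone_the_inv_into(2)[OF mon] measurable_cong_sets by blast
  define N where "N = distr (restrict_space M (f ` I)) borel ?k"
  define R where "R = scale_measure (ennreal l) (density M (indicator I))"
  \<comment> \<open>Images under \<open>f\<close> are preimages under its Borel inverse; this gives
    their measurability.\<close>
  have vim: "?k -` B \<inter> f ` I = f ` (I \<inter> B)" for B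
    using the_inv_into_f_f[OF inj] by auto
  have im: "f ` (I \<inter> B) \<in> sets borel" if B: "B \<in> sets borel" for B
  proof -
    have "?k -` B \<inter> space (restrict_space borel (f ` I)) \<in> sets (restrict_space borel (f ` I))"
      using strict_monotone_the_inv_into(2)[OF mon] B by (rule measurable_sets)
    then show ?thesis
      using fI vim by (simp add: space_restrict_space sets_restrict_space_iff)
  qed
  have N: "emeasure N B = emeasure M (f ` (I \<inter> B))" if "B \<in> sets borel" for B
  proof -
    have "emeasure N B = emeasure (restrict_space M (f ` I)) (f ` (I \<inter> B))"
      unfolding N_def using that by (subst emeasure_distr[OF k]) (simp_all add: space_restrict_space vim sp)
    also have "\<dots> = emeasure M (f ` (I \<inter> B))"
      using fI M(2) by (intro emeasure_restrict_space) auto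
    finally show ?thesis .
  qed
  have R: "emeasure R B = ennreal l * emeasure M (I \<inter> B)" if "B \<in> sets borel" for B
  proof -
    have "emeasure (density M (indicator I)) B = emeasure M (I \<inter> B)"
      using that I' M(2) by (subst emeasure_density)
        (auto simp: nn_integral_indicator simp flip: indicator_inter_arith)
    then show ?thesis unfolding R_def by simp
  qed
  have sets: "sets N = sets borel" "sets R = sets borel"
    unfolding N_def R_def using M(2) by auto
  have sub: "{x..y} \<subseteq> I" if "x \<in> I" "y \<in> I" for x y
    using I that unfolding is_interval_1 by (meson atLeastAtMost_iff subsetI)
  have NR: "emeasure N {u..v} = emeasure R {u..v}" for u v :: real
  proof -
    \<comment> \<open>The hypothesis \<open>eq\<close> covers only compact intervals inside
      \<open>I\<close>, and this intersection need not be closed, hence the exhaustion.\<close>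
    have "is_interval (I \<inter> {u..v})" using I by (intro is_interval_Int is_interval_cc)
    then have "emeasure N (I \<inter> {u..v}) = emeasure R (I \<inter> {u..v})"
    proof (rule emeasure_interval_cong[OF sets])
      fix x y assume "x \<in> I \<inter> {u..v}" "y \<in> I \<inter> {u..v}" "x \<le> y"
      then have "x \<in> I" "y \<in> I" by auto
      then show "emeasure N {x..y} = emeasure R {x..y}"
        using N[of "{x..y}"] R[of "{x..y}"] eq[of x y] sub[of x y] \<open>x \<le> y\<close>
        by (simp add: Int_absorb1)
    qed
    then show ?thesis
      using N[of "{u..v}"] N[of "I \<inter> {u..v}"] R[of "{u..v}"] R[of "I \<inter> {u..v}"] I' by simp
  qed
  have "N = R"
  proof (rule measure_eqI_generator_eq[where \<Omega> = UNIV and E = "range (\<lambda>(a,b). {a..b::real})"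
        and A = "\<lambda>n. {- real n..real n}"])
    show "Int_stable (range (\<lambda>(a,b). {a..b::real}))"
      by (auto simp: Int_stable_def image_iff)
    show "sets N = sigma_sets UNIV (range (\<lambda>(a,b). {a..b::real}))"
      unfolding sets by (subst borel_eq_atLeastAtMost) simp
    show "sets R = sigma_sets UNIV (range (\<lambda>(a,b). {a..b::real}))"
      unfolding sets by (subst borel_eq_atLeastAtMost) simp
    show "(\<Union>n. {- real n..real n}) = UNIV"
    proof (intro set_eqI iffI UNIV_I)
      fix x :: real
      obtain n where "\<bar>x\<bar> \<le> real n" using real_arch_simple by blast
      then show "x \<in> (\<Union>n. {- real n..real n})" by (auto intro!: exI[of _ n])
    qed
    show "emeasure N {- real n..real n} \<noteq> \<infinity>" for n
      using N[of "{- real n..real n}"] by (simp add: emeasure_finite)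
  qed (auto simp: NR)
  then show "emeasure M (f ` (I \<inter> A)) = ennreal l * emeasure M (I \<inter> A)"
    using N[OF A] R[OF A] by simp
qed

section \<open>Countable additivity over families and nonatomicity\<close>

text \<open>Countable additivity in the shape of the sum in \<open>transfer\<close>, which runs over
  a family of intervals instead of the natural numbers. An infinite family is reindexed by an
  enumeration.\<close>

lemma infsum_emeasure_disjoint:
  assumes "countable \<B>" "disjoint_family_on X \<B>" "\<And>i. i \<in> \<B> \<Longrightarrow> X i \<in> sets M"
  shows "(\<Sum>\<^sub>\<infinity>i\<in>\<B>. emeasure M (X i)) = emeasure M (\<Union>(X ` \<B>))"
proof (cases "finite \<B>")
  case True
  then show ?thesis
    using assms by (simp add: sum_emeasure image_subset_iff)
next
  case False
  let ?b = "from_nat_into \<B>"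
  have b: "bij_betw ?b UNIV \<B>" using assms(1) False by (rule bij_betw_from_nat_into)
  have mem: "?b n \<in> \<B>" for n using b by (auto simp: bij_betw_def)
  have dis: "disjoint_family (\<lambda>n. X (?b n))"
    unfolding disjoint_family_on_def
  proof (intro ballI impI)
    fix m n :: nat assume "m \<noteq> n"
    then have "?b m \<noteq> ?b n" using b unfolding bij_betw_def by (meson inj_eq)
    then show "X (?b m) \<inter> X (?b n) = {}"
      using assms(2) mem unfolding disjoint_family_on_def by blast
  qed
  have "(\<Sum>\<^sub>\<infinity>i\<in>\<B>. emeasure M (X i)) = (\<Sum>\<^sub>\<infinity>n. emeasure M (X (?b n)))"
    by (rule infsum_reindex_bij_betw[OF b, symmetric])
  also have "\<dots> = (\<Sum>n. emeasure M (X (?b n)))"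
    by (intro sums_unique has_sum_imp_sums has_sum_infsum nonneg_summable_on_complete) simp
  also have "\<dots> = emeasure M (\<Union>n. X (?b n))"
    using assms(3)[OF mem] dis by (intro suminf_emeasure) auto
  also have "(\<Union>n. X (?b n)) = \<Union>(X ` \<B>)"
    using b unfolding bij_betw_def by (metis image_image)
  finally show ?thesis .
qed

text \<open>Null points make the distribution function of the measure restricted to \<open>A\<close>
  continuous. By the intermediate value theorem some half-line then cuts off exactly half of the
  mass of \<open>A\<close>.\<close>

lemma (in finite_borel_measure) ex_subset_smaller_measure:
  assumes pt: "\<And>x. measure M {x} = 0" and A: "A \<in> sets borel" "emeasure M A > 0"
  shows "\<exists>B\<in>sets borel. B \<subseteq> A \<and> 0 < emeasure M B \<and> emeasure M B < emeasure M A"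
proof -
  let ?N = "density M (indicator A)"
  have AM: "A \<in> sets M" using A M_is_borel by simp
  have Ne: "emeasure ?N B = emeasure M (A \<inter> B)" if "B \<in> sets borel" for B
    using that AM M_is_borel by (subst emeasure_density)
      (auto simp: nn_integral_indicator simp flip: indicator_inter_arith)
  then have Nm: "measure ?N B = measure M (A \<inter> B)" if "B \<in> sets borel" for B
    using that by (simp add: measure_def)
  interpret N: finite_borel_measure ?N
  proof (intro finite_borel_measure.intro finite_borel_measure_axioms.intro finite_measureI)
    show "emeasure ?N (space ?N) \<noteq> \<infinity>"
      using Ne[of UNIV] emeasure_finite by (simp add: borel_UNIV)
    show "sets ?N = sets borel" using M_is_borel by simp
  qed
  have spN: "space ?N = UNIV" by (rule N.borel_UNIV)
  have "measure ?N {x} = 0" for x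
  proof -
    have "measure M (A \<inter> {x}) \<le> measure M {x}"
      using M_is_borel by (intro finite_measure_mono) auto
    then show ?thesis using pt Nm[of "{x}"] by (simp add: measure_le_0_iff)
  qed
  then have cont: "isCont (cdf ?N) x" for x by (simp add: N.isCont_cdf)
  have m0: "measure M A > 0" using A(2) by (simp add: emeasure_eq_measure)
  have top: "measure ?N (space ?N) = measure M A" using Nm[of UNIV] spN by simp
  have "eventually (\<lambda>x. cdf ?N x < measure M A / 2) at_bot"
    using N.cdf_lim_at_bot m0 by (intro order_tendstoD) auto
  then obtain a where a: "cdf ?N a < measure M A / 2"
    by (meson eventually_at_bot_linorder order_refl)
  have "eventually (\<lambda>x. cdf ?N x > measure M A / 2) at_top"
    using N.cdf_lim_at_top m0 top by (intro order_tendstoD) auto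
  then obtain b where b: "cdf ?N b > measure M A / 2"
    by (meson eventually_at_top_linorder order_refl)
  have "a \<le> b" using a b N.cdf_nondecreasing[of b a] by linarith
  then obtain t where "cdf ?N t = measure M A / 2"
    using IVT[of "cdf ?N" a "measure M A / 2" b] a b cont by auto
  then have "measure M (A \<inter> {..t}) = measure M A / 2"
    using Nm[of "{..t}"] by (simp add: cdf_def)
  then show ?thesis
    using A m0 by (intro bexI[of _ "A \<inter> {..t}"]) (auto simp: emeasure_eq_measure ennreal_less_iff)
qed

section \<open>Images of compact intervals and the Stieltjes measure\<close>

text \<open>Writing the endpoints with \<open>min\<close> and \<open>max\<close> lets later
  arguments treat increasing and decreasing branches together.\<close>

lemma monotone_image_Icc:
  fixes f :: "real \<Rightarrow> real"
  assumes cont: "continuous_on {x..y} f" and xy: "x \<le> y"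
    and mon: "strict_mono_on {x..y} f \<or> strict_antimono_on {x..y} f"
  shows "f ` {x..y} = {min (f x) (f y)..max (f x) (f y)}"
proof
  have "connected (f ` {x..y})" using cont by (intro connected_continuous_image) auto
  moreover have "min (f x) (f y) \<in> f ` {x..y}" "max (f x) (f y) \<in> f ` {x..y}"
    using xy by (auto simp: min_def max_def)
  ultimately show "{min (f x) (f y)..max (f x) (f y)} \<subseteq> f ` {x..y}"
    by (rule connected_contains_Icc)
  show "f ` {x..y} \<subseteq> {min (f x) (f y)..max (f x) (f y)}"
  proof clarify
    fix z assume z: "z \<in> {x..y}"
    have "x \<in> {x..y}" "y \<in> {x..y}" using xy by auto
    then have "f x \<le> f z \<and> f z \<le> f y \<or> f y \<le> f z \<and> f z \<le> f x"
      using mon z unfolding monotone_on_def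
      by (metis atLeastAtMost_iff order_le_less)
    then show "f z \<in> {min (f x) (f y)..max (f x) (f y)}" by auto
  qed
qed

lemma basic_interval_image_Icc:
  assumes reg: "regular_off P f" and I: "I \<in> basic_intervals P" and xy: "x \<in> I" "y \<in> I" "x \<le> y"
  shows "{x..y} \<subseteq> I" "f ` {x..y} = {min (f x) (f y)..max (f x) (f y)}"
    "min (f x) (f y) \<in> {0..1}" "max (f x) (f y) \<in> {0..1}"
proof -
  show sub: "{x..y} \<subseteq> I"
    using basic_intervalD(2)[OF I] xy unfolding is_interval_1 by (meson atLeastAtMost_iff subsetI)
  have "continuous_on I f" "strict_mono_on I f \<or> strict_antimono_on I f"
    using reg I unfolding regular_off_def by blast+
  then have "continuous_on {x..y} f" "strict_mono_on {x..y} f \<or> strict_antimono_on {x..y} f"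
    using continuous_on_subset[OF _ sub] monotone_on_subset[OF _ sub] by metis+
  then show "f ` {x..y} = {min (f x) (f y)..max (f x) (f y)}"
    using monotone_image_Icc xy(3) by blast
  have "f x \<in> {0..1}" "f y \<in> {0..1}"
    using reg basic_intervalD(1)[OF I] xy unfolding regular_off_def by blast+
  then show "min (f x) (f y) \<in> {0..1}" "max (f x) (f y) \<in> {0..1}"
    by (auto simp: min_def max_def)
qed

lemma mono_surj_endpoints:
  assumes "mono_on {0..1} \<phi>" "\<phi> ` {0..1} = {0..1::real}"
  shows "\<phi> (0::real) = 0" "\<phi> 1 = 1"
proof -
  have "0 \<in> \<phi> ` {0..1}" "1 \<in> \<phi> ` {0..1}" unfolding assms(2) by simp_all
  then obtain x y where xy: "x \<in> {0..1}" "\<phi> x = 0" "y \<in> {0..1}" "\<phi> y = 1"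
    by (metis imageE)
  have "\<phi> 0 \<le> \<phi> x" "\<phi> y \<le> \<phi> 1"
    using mono_onD[OF assms(1), of 0 x] mono_onD[OF assms(1), of y 1] xy by auto
  moreover have "\<phi> 0 \<in> {0..1}" "\<phi> 1 \<in> {0..1}" using assms(2) by force+
  ultimately show "\<phi> 0 = 0" "\<phi> 1 = 1" using xy by auto
qed

text \<open>\<open>M\<close> is the Stieltjes measure of \<open>\<phi>\<close>, extended constantly
  beyond [0,1]. Points are null because the extension is continuous.\<close>

lemma pullback_of_Lebesgue:
  fixes \<phi> :: "real \<Rightarrow> real"
  assumes \<phi>: "continuous_on {0..1} \<phi>" "mono_on {0..1} \<phi>" "\<phi> ` {0..1} = {0..1}"
  obtains M where "real_distribution M" "\<And>x. emeasure M {x} = 0"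
    "\<And>x y. x \<in> {0..1} \<Longrightarrow> y \<in> {0..1} \<Longrightarrow> x \<le> y \<Longrightarrow> emeasure M {x..y} = ennreal (\<phi> y - \<phi> x)"
proof -
  \<comment> \<open>Clamping the argument gives a continuous distribution function on the whole
    line, equal to 0 left of 0 and to 1 right of 1.\<close>
  define F where "F x = \<phi> (max 0 (min 1 x))" for x
  have clamp: "max 0 (min 1 x) \<in> {0..1}" for x :: real by auto
  have mono: "F x \<le> F y" if "x \<le> y" for x y
    unfolding F_def using that clamp by (intro mono_onD[OF \<phi>(2)]) auto
  have cont: "continuous_on UNIV F"
    unfolding F_def
    by (rule continuous_on_compose2[OF \<phi>(1)]) (use clamp in \<open>auto intro!: continuous_intros\<close>)
  have F_id: "F x = \<phi> x" if "x \<in> {0..1}" for x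
    using that by (simp add: F_def min_absorb2 max_absorb2)
  have F0: "F x = 0" if "x \<le> 0" for x
    using that mono_surj_endpoints[OF \<phi>(2,3)] by (simp add: F_def max_def min_def)
  have F1: "F x = 1" if "x \<ge> 1" for x
    using that mono_surj_endpoints[OF \<phi>(2,3)] by (simp add: F_def max_def min_def)
  have Icc: "emeasure (interval_measure F) {a..b} = ennreal (F b - F a)" if "a \<le> b" for a b
    using that mono cont by (rule emeasure_interval_measure_Icc)
  have "real_distribution (interval_measure F)"
  proof (rule real_distribution_interval_measure[OF mono])
    show "continuous (at_right a) F" for a
      using cont by (simp add: continuous_on_eq_continuous_at continuous_at_imp_continuous_within)
    show "(F \<longlongrightarrow> 0) at_bot"
      using F0 by (intro tendsto_eventually) (auto simp: eventually_at_bot_linorder)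
    show "(F \<longlongrightarrow> 1) at_top"
      using F1 by (intro tendsto_eventually) (auto simp: eventually_at_top_linorder)
  qed
  moreover have "emeasure (interval_measure F) {x} = 0" for x
    using Icc[of x x] by simp
  moreover have "emeasure (interval_measure F) {x..y} = ennreal (\<phi> y - \<phi> x)"
    if "x \<in> {0..1}" "y \<in> {0..1}" "x \<le> y" for x y
    using Icc[OF that(3)] F_id that by simp
  ultimately show ?thesis by (rule that)
qed

section \<open>From a semiconjugacy to an eigenmeasure\<close>

text \<open>For the Stieltjes measure of \<open>\<phi>\<close>, the increment identity says that
  \<open>f\<close> multiplies the measure of compact intervals inside a basic interval by
  \<open>l\<close>. This extends to Borel sets, and summing over basic intervals loses only the null
  set \<open>Q\<close>.\<close>

lemma measure_of_semiconjugacy: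
  assumes f: "f \<in> class_C" and semi: "semiconjugates \<phi> f g" and slope: "constant_slope g l"
    and l: "l > 0"
  shows "\<exists>\<mu>. prob_space \<mu> \<and> \<mu> \<in> class_M \<and> transfer f \<mu> = scale_measure (ennreal l) \<mu>"
proof -
  have \<phi>: "continuous_on {0..1} \<phi>" "mono_on {0..1} \<phi>" "\<phi> ` {0..1} = {0..1}"
    using semi unfolding semiconjugates_def by auto
  obtain M where M: "real_distribution M" "\<And>x. emeasure M {x} = 0"
    "\<And>x y. x \<in> {0..1} \<Longrightarrow> y \<in> {0..1} \<Longrightarrow> x \<le> y \<Longrightarrow> emeasure M {x..y} = ennreal (\<phi> y - \<phi> x)"
    using pullback_of_Lebesgue[OF \<phi>] by metis
  interpret M: real_distribution M by (rule M(1))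
  have sM: "sets M = sets borel" by simp
  define \<mu> where "\<mu> = restrict_space M {0..1}"
  let ?S = "sets (restrict_space borel {0..1::real})"
  have sets_\<mu>: "sets \<mu> = ?S" unfolding \<mu>_def using sM by (rule sets_restrict_space_cong)
  have space_\<mu>: "space \<mu> = {0..1}" unfolding \<mu>_def by (simp add: space_restrict_space)
  have S: "A \<in> ?S \<longleftrightarrow> A \<in> sets borel \<and> A \<subseteq> {0..1}" for A
    by (simp add: sets_restrict_space_iff conj_commute)
  have em: "emeasure \<mu> A = emeasure M A" if "A \<subseteq> {0..1}" for A
    unfolding \<mu>_def using that by (intro emeasure_restrict_space) auto
  have "emeasure M {0..1} = 1"
    using M(3)[of 0 1] mono_surj_endpoints[OF \<phi>(2,3)] by simp
  then have prob: "prob_space \<mu>" unfolding \<mu>_def by (intro prob_space_restrict_space) auto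
  have "nonatomic \<mu>"
    unfolding nonatomic_def
  proof (intro ballI impI)
    fix A assume A: "A \<in> sets \<mu>" "emeasure \<mu> A > 0"
    then have A': "A \<in> sets borel" "A \<subseteq> {0..1}" using sets_\<mu> S by auto
    have "measure M {x} = 0" for x using M(2) by (simp add: measure_def)
    then obtain B where B: "B \<in> sets borel" "B \<subseteq> A" "0 < emeasure M B" "emeasure M B < emeasure M A"
      using M.ex_subset_smaller_measure[OF _ A'(1)] A(2) em[OF A'(2)] by auto
    have "B \<subseteq> {0..1}" using B(2) A'(2) by blast
    then show "\<exists>B\<in>sets \<mu>. B \<subseteq> A \<and> 0 < emeasure \<mu> B \<and> emeasure \<mu> B < emeasure \<mu> A"
      using B em A'(2) sets_\<mu> S by (intro bexI[of _ B]) auto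
  qed
  moreover have "strongly_sigma_finite \<mu>"
    unfolding strongly_sigma_finite_def
  \<comment> \<open>The measure is finite, so the empty set is a witness.\<close>
  proof (intro exI[of _ "{}"] conjI ballI)
    interpret prob_space \<mu> by fact
    show "emeasure \<mu> I < \<infinity>" for I by (simp add: emeasure_eq_measure)
  qed (simp add: small_set_def)
  ultimately have class_mu: "\<mu> \<in> class_M" using sets_\<mu> unfolding class_M_def by blast
  \<comment> \<open>This is the very choice made inside \<open>transfer\<close>, so unfolding that
    definition produces this \<open>Q\<close>.\<close>
  define Q where "Q = (SOME P. admissible f P)"
  have Q: "admissible f Q"
    unfolding Q_def using f someI_ex[of "admissible f"] unfolding class_C_def by blast
  let ?f = "version f Q"
  note reg = version_props(2)[OF Q]
  have img: "?f ` (I \<inter> A) \<subseteq> {0..1}" if "I \<in> basic_intervals Q" for I A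
    using reg basic_intervalD(1)[OF that] unfolding regular_off_def by blast
  have scale: "emeasure M (?f ` (I \<inter> A)) = ennreal l * emeasure M (I \<inter> A)"
    if I: "I \<in> basic_intervals Q" and A: "A \<in> sets borel" for I A
  proof (rule emeasure_image_scale[OF M.finite_measure_axioms sM _ _ _ _ A])
    show "is_interval I" using basic_intervalD[OF I] by blast
    show "continuous_on I ?f" "strict_mono_on I ?f \<or> strict_antimono_on I ?f"
      using reg I unfolding regular_off_def by blast+
    fix x y assume xy: "x \<in> I" "y \<in> I" "x \<le> y"
    note im = basic_interval_image_Icc[OF reg I xy]
    have xy01: "x \<in> {0..1}" "y \<in> {0..1}" using basic_intervalD(1)[OF I] xy by blast+
    have "min (?f x) (?f y) \<le> max (?f x) (?f y)" by simp
    then have "\<phi> (max (?f x) (?f y)) - \<phi> (min (?f x) (?f y)) = \<bar>\<phi> (?f y) - \<phi> (?f x)\<bar>"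
      using mono_onD[OF \<phi>(2) im(3,4)] by (auto simp: max_def min_def)
    also have "\<dots> = l * \<bar>\<phi> y - \<phi> x\<bar>"
      using semiconjugate_increment[OF semi slope _ Q I xy(1,2)] l by simp
    also have "\<dots> = l * (\<phi> y - \<phi> x)"
      using mono_onD[OF \<phi>(2) xy01 xy(3)] by simp
    finally show "emeasure M (?f ` {x..y}) = ennreal l * emeasure M {x..y}"
      unfolding im(2) using M(3)[OF im(3,4)] M(3)[OF xy01 xy(3)] mono_onD[OF \<phi>(2) xy01 xy(3)] l
      by (simp add: ennreal_mult)
  qed
  have cB: "countable (basic_intervals Q)" and Qc: "countable Q"
    using Q countable_basic_intervals unfolding admissible_def small_set_def by blast+
  have "(\<Union>x\<in>Q. {x}) \<in> null_sets M"
    using Qc M(2) by (intro null_sets_UN') (auto intro: null_setsI)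
  then have Q0: "Q \<in> null_sets M" by simp
  have total: "(\<Sum>\<^sub>\<infinity>I\<in>basic_intervals Q. emeasure \<mu> (?f ` (I \<inter> A))) = ennreal l * emeasure \<mu> A"
    if "A \<in> ?S" for A
  proof -
    have A: "A \<in> sets borel" "A \<subseteq> {0..1}" using that S by auto
    have "(\<Sum>\<^sub>\<infinity>I\<in>basic_intervals Q. emeasure \<mu> (?f ` (I \<inter> A)))
        = (\<Sum>\<^sub>\<infinity>I\<in>basic_intervals Q. emeasure (scale_measure (ennreal l) M) (I \<inter> A))"
      using em[OF img] scale A by (intro infsum_cong) simp
    also have "\<dots> = emeasure (scale_measure (ennreal l) M) (\<Union>I\<in>basic_intervals Q. I \<inter> A)"
    proof (rule infsum_emeasure_disjoint[OF cB])
      show "disjoint_family_on (\<lambda>I. I \<inter> A) (basic_intervals Q)"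
        using disjoint_basic_intervals unfolding disjoint_family_on_def disjoint_def by blast
      show "I \<inter> A \<in> sets (scale_measure (ennreal l) M)" if "I \<in> basic_intervals Q" for I
        using real_interval_borel_measurable[OF basic_intervalD(2)[OF that]] A by simp
    qed
    also have "(\<Union>I\<in>basic_intervals Q. I \<inter> A) = A - Q"
      using Union_basic_intervals[of Q] A(2) by blast
    also have "emeasure (scale_measure (ennreal l) M) (A - Q) = ennreal l * emeasure M A"
      using emeasure_Diff_null_set[OF Q0, of A] A by simp
    finally show ?thesis using em[OF A(2)] by simp
  qed
  have "transfer f \<mu> = measure_of {0..1} ?S
      (\<lambda>A. \<Sum>\<^sub>\<infinity>I\<in>basic_intervals Q. emeasure \<mu> (?f ` (I \<inter> A)))"
    unfolding transfer_def Q_def Let_def ..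
  also have "\<dots> = measure_of {0..1} ?S (emeasure (scale_measure (ennreal l) \<mu>))"
  \<comment> \<open>On the sigma-algebra the defining sum equals the measure \<open>l \<mu>\<close>,
    so \<open>measure_of\<close> inherits countable additivity from it.\<close>
  proof (rule measure_of_eq)
    show "?S \<subseteq> Pow {0..1}" using S by blast
    have "sigma_sets {0..1} ?S = ?S"
      using sets.sigma_sets_eq[of "restrict_space borel {0..1::real}"] by (simp add: space_restrict_space)
    then show "(\<Sum>\<^sub>\<infinity>I\<in>basic_intervals Q. emeasure \<mu> (?f ` (I \<inter> A)))
        = emeasure (scale_measure (ennreal l) \<mu>) A" if "A \<in> sigma_sets {0..1} ?S" for A
      using that total by simp
  qed
  also have "\<dots> = scale_measure (ennreal l) \<mu>"
    using measure_of_of_measure[of "scale_measure (ennreal l) \<mu>"] sets_\<mu> space_\<mu>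
    by (simp add: space_scale_measure)
  finally show ?thesis using prob class_mu by blast
qed

section \<open>From an eigenmeasure to a semiconjugacy\<close>

text \<open>Relative to a base point \<open>z\<close>, the sign of the increment of
  \<open>\<phi> \<circ> f\<close> depends only on the side of \<open>z\<close> and the direction of
  \<open>f\<close>. Removing the absolute values therefore leaves one global sign.\<close>

lemma affine_factor_on_basic_interval:
  fixes \<phi> f :: "real \<Rightarrow> real"
  assumes \<phi>: "mono_on {0..1} \<phi>" and reg: "regular_off P f" and I: "I \<in> basic_intervals P"
    and l: "l \<ge> 0"
    and incr: "\<And>x y. x \<in> I \<Longrightarrow> y \<in> I \<Longrightarrow> \<bar>\<phi> (f y) - \<phi> (f x)\<bar> = l * \<bar>\<phi> y - \<phi> x\<bar>"
  shows "\<exists>a b. \<bar>a\<bar> = l \<and> (\<forall>x\<in>I. \<phi> (f x) = a * \<phi> x + b)"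
proof -
  obtain z where z: "z \<in> I" using basic_intervalD(3)[OF I] by blast
  have I01: "x \<in> {0..1}" "f x \<in> {0..1}" if "x \<in> I" for x
    using basic_intervalD(1)[OF I] reg that unfolding regular_off_def by blast+
  have "strict_mono_on I f \<or> strict_antimono_on I f"
    using reg I unfolding regular_off_def by blast
  \<comment> \<open>\<open>s\<close> is 1 if \<open>f\<close> increases and -1 if it decreases. At
    \<open>x = z\<close> both sides vanish, so either choice of the last factor is consistent
    there.\<close>
  then obtain s :: real where s: "\<bar>s\<bar> = 1"
    "\<And>x. x \<in> I \<Longrightarrow> \<phi> (f x) - \<phi> (f z) = s * \<bar>\<phi> (f x) - \<phi> (f z)\<bar> * (if x \<le> z then -1 else 1)"
  proof
    assume m: "strict_mono_on I f"
    have "\<phi> (f x) - \<phi> (f z) = 1 * \<bar>\<phi> (f x) - \<phi> (f z)\<bar> * (if x \<le> z then -1 else 1)"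
      if x: "x \<in> I" for x
    proof (cases "x \<le> z")
      case True
      then have "f x \<le> f z" using m x z unfolding monotone_on_def by (metis order_le_less)
      then show ?thesis using True mono_onD[OF \<phi>] I01 x z by force
    next
      case False
      then have "f z \<le> f x" using m x z unfolding monotone_on_def by (metis linorder_not_le order_le_less)
      then show ?thesis using False mono_onD[OF \<phi>] I01 x z by force
    qed
    then show ?thesis using that[of 1] by simp
  next
    assume m: "strict_antimono_on I f"
    have "\<phi> (f x) - \<phi> (f z) = -1 * \<bar>\<phi> (f x) - \<phi> (f z)\<bar> * (if x \<le> z then -1 else 1)"
      if x: "x \<in> I" for x
    proof (cases "x \<le> z")
      case True
      then have "f z \<le> f x" using m x z unfolding monotone_on_def by (metis order_le_less)
      then show ?thesis using True mono_onD[OF \<phi>] I01 x z by force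
    next
      case False
      then have "f x \<le> f z" using m x z unfolding monotone_on_def by (metis linorder_not_le order_le_less)
      then show ?thesis using False mono_onD[OF \<phi>] I01 x z by force
    qed
    then show ?thesis using that[of "-1"] by simp
  qed
  have "\<phi> (f x) = (s * l) * \<phi> x + (\<phi> (f z) - s * l * \<phi> z)" if x: "x \<in> I" for x
  proof -
    have "\<bar>\<phi> x - \<phi> z\<bar> * (if x \<le> z then -1 else 1) = \<phi> x - \<phi> z"
      using mono_onD[OF \<phi> I01(1)[OF x] I01(1)[OF z]] mono_onD[OF \<phi> I01(1)[OF z] I01(1)[OF x]]
      by auto
    then have "\<phi> (f x) - \<phi> (f z) = s * l * (\<phi> x - \<phi> z)"
      using s(2)[OF x] incr[OF z x] by (metis mult.assoc)
    then show ?thesis by (simp add: algebra_simps)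
  qed
  moreover have "\<bar>s * l\<bar> = l" using s(1) l by (simp add: abs_mult)
  ultimately show ?thesis by blast
qed

text \<open>The map \<open>g\<close> lifts \<open>y\<close> to a preimage under
  \<open>\<phi>\<close>, applies \<open>f\<close> and projects back. Off \<open>R\<close> this does
  not depend on the lift: the fibre lies in one basic interval, where \<open>incr\<close> turns
  equal values of \<open>\<phi>\<close> into equal values of
  \<open>\<phi> \<circ> f\<close>.\<close>

lemma constant_slope_factor:
  fixes \<phi> :: "real \<Rightarrow> real"
  assumes \<phi>: "continuous_on {0..1} \<phi>" "mono_on {0..1} \<phi>" "\<phi> ` {0..1} = {0..1}"
    and Q: "admissible f Q" and l: "l > 0"
    and incr: "\<And>I x y. I \<in> basic_intervals Q \<Longrightarrow> x \<in> I \<Longrightarrow> y \<in> I \<Longrightarrow>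
      \<bar>\<phi> (version f Q y) - \<phi> (version f Q x)\<bar> = l * \<bar>\<phi> y - \<phi> x\<bar>"
  shows "\<exists>g. g \<in> class_C \<and> constant_slope g l \<and> semiconjugates \<phi> f g"
proof -
  let ?f = "version f Q"
  note reg = version_props(2)[OF Q]
  have sQ: "small_set Q" using Q unfolding admissible_def by blast
  have \<phi>01: "\<phi> x \<in> {0..1}" if "x \<in> {0..1}" for x
    using imageI[OF that, of \<phi>] unfolding \<phi>(3) .
  have onto: "\<exists>x\<in>{0..1}. y = \<phi> x" if "y \<in> {0..1}" for y
    using that \<phi>(3) by (metis imageE)
  define R where "R = \<phi> ` Q"
  have "compact Q" using sQ bounded_closed_interval bounded_subset
    unfolding small_set_def compact_eq_bounded_closed by blast
  then have "closed R"
    unfolding R_def using sQ continuous_on_subset[OF \<phi>(1)]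
    by (intro compact_imp_closed compact_continuous_image) (auto simp: small_set_def)
  moreover have "countable R" "R \<subseteq> {0..1}"
    using sQ image_mono[of Q "{0..1}" \<phi>] \<phi>(3) unfolding small_set_def R_def by auto
  ultimately have sR: "small_set R" unfolding small_set_def by blast
  \<comment> \<open>The preimage of \<open>J\<close> under the nondecreasing \<open>\<phi>\<close>
    is an interval, and it misses \<open>Q\<close> since \<open>J\<close> misses \<open>R\<close>;
    hence it lies in a single component.\<close>
  have fiber: "\<exists>I\<in>basic_intervals Q. \<forall>x\<in>{0..1}. \<phi> x \<in> J \<longrightarrow> x \<in> I"
    if J: "J \<in> basic_intervals R" for J
  proof -
    let ?T = "{x \<in> {0..1}. \<phi> x \<in> J}"
    note J' = basic_intervalD[OF J]
    have "is_interval ?T"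
      unfolding is_interval_1
    proof (intro ballI allI impI)
      fix a b x assume ab: "a \<in> ?T" "b \<in> ?T" "a \<le> x \<and> x \<le> b"
      then have x: "x \<in> {0..1}" by auto
      have "\<phi> a \<le> \<phi> x" "\<phi> x \<le> \<phi> b" using mono_onD[OF \<phi>(2), of a x] mono_onD[OF \<phi>(2), of x b] ab x by auto
      then have "\<phi> x \<in> J" using J'(2) ab unfolding is_interval_1 by blast
      then show "x \<in> ?T" using x by blast
    qed
    then have T: "connected ?T" unfolding is_interval_connected_1 .
    have T0: "?T \<noteq> {}"
    proof -
      obtain y where y: "y \<in> J" using J'(3) by blast
      then obtain x where "x \<in> {0..1}" "y = \<phi> x" using J'(1) onto[of y] by blast
      then show ?thesis using y by blast
    qed
    have "?T \<subseteq> {0..1} - Q" using J'(1) unfolding R_def by blast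
    then obtain I where "I \<in> basic_intervals Q" "?T \<subseteq> I"
      by (rule basic_interval_superset[OF T T0])
    then show ?thesis by blast
  qed
  define g where "g y = \<phi> (?f (SOME x. x \<in> {0..1} \<and> \<phi> x = y))" for y
  have g: "g (\<phi> x) = \<phi> (?f x)" if x: "x \<in> {0..1}" "\<phi> x \<notin> R" for x
  proof -
    define x' where "x' = (SOME z. z \<in> {0..1} \<and> \<phi> z = \<phi> x)"
    have x': "x' \<in> {0..1}" "\<phi> x' = \<phi> x"
      unfolding x'_def using someI[of "\<lambda>z. z \<in> {0..1} \<and> \<phi> z = \<phi> x" x] x by auto
    have "\<phi> x \<in> {0..1} - R" using x \<phi>01 by blast
    then obtain J where "J \<in> basic_intervals R" "\<phi> x \<in> J"
      using Union_basic_intervals by blast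
    then obtain I where "I \<in> basic_intervals Q" "\<forall>z\<in>{0..1}. \<phi> z \<in> J \<longrightarrow> z \<in> I" "\<phi> x \<in> J"
      using fiber by blast
    then have I: "I \<in> basic_intervals Q" "x \<in> I" "x' \<in> I" using x(1) x' by auto
    have "\<bar>\<phi> (?f x') - \<phi> (?f x)\<bar> = 0" using incr[OF I] x'(2) by simp
    then show ?thesis unfolding g_def x'_def by simp
  qed
  have affine: "\<exists>a b. \<bar>a\<bar> = l \<and> (\<forall>x\<in>I. \<phi> (?f x) = a * \<phi> x + b)"
    if I: "I \<in> basic_intervals Q" for I
    using \<phi>(2) reg I less_imp_le[OF l] incr[OF I] by (rule affine_factor_on_basic_interval)
  have gaff: "\<exists>a b. \<bar>a\<bar> = l \<and> (\<forall>y\<in>J. g y = a * y + b)" if J: "J \<in> basic_intervals R" for J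
  proof -
    obtain I where I: "I \<in> basic_intervals Q" "\<And>x. x \<in> {0..1} \<Longrightarrow> \<phi> x \<in> J \<Longrightarrow> x \<in> I"
      using fiber[OF J] by metis
    obtain a b where ab: "\<bar>a\<bar> = l" "\<And>x. x \<in> I \<Longrightarrow> \<phi> (?f x) = a * \<phi> x + b"
      using affine[OF I(1)] by blast
    have "g y = a * y + b" if y: "y \<in> J" for y
    proof -
      have "y \<in> {0..1} - R" using basic_intervalD(1)[OF J] y by blast
      then obtain x where x: "x \<in> {0..1}" "y = \<phi> x" "\<phi> x \<notin> R" using onto[of y] by blast
      then show ?thesis using g[OF x(1,3)] ab(2)[OF I(2)[OF x(1)]] y by simp
    qed
    then show ?thesis using ab(1) by blast
  qed
  have regg: "regular_off R g"
    unfolding regular_off_def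
  proof (intro conjI ballI)
    show "g ` ({0..1} - R) \<subseteq> {0..1}"
    proof clarify
      fix y assume y: "y \<in> {0..1}" "y \<notin> R"
      then obtain x where x: "x \<in> {0..1}" "y = \<phi> x" using onto by blast
      then have "x \<in> {0..1} - Q" using y unfolding R_def by blast
      then have "?f x \<in> {0..1}" using reg unfolding regular_off_def by blast
      then have "\<phi> (?f x) \<in> {0..1}" using \<phi>01 by blast
      then show "g y \<in> {0..1}" using g[OF x(1)] x y by simp
    qed
    fix J assume J: "J \<in> basic_intervals R"
    obtain a b where ab: "\<bar>a\<bar> = l" "\<And>y. y \<in> J \<Longrightarrow> g y = a * y + b" using gaff[OF J] by blast
    have "continuous_on J (\<lambda>y. a * y + b)" by (intro continuous_intros)
    then show "continuous_on J g" using ab(2) by (simp cong: continuous_on_cong)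
    \<comment> \<open>Positivity of \<open>l\<close> enters here: a nonzero slope makes the affine
      pieces strictly monotone.\<close>
    have "a > 0 \<or> a < 0" using ab(1) l by linarith
    then show "strict_mono_on J g \<or> strict_antimono_on J g"
      using ab(2) by (auto simp: monotone_on_def)
  qed
  have same: "same_map g g" unfolding same_map_def small_set_def by (intro exI[of _ "{}"]) auto
  have adm: "admissible g R" unfolding admissible_def using sR same regg by blast
  have ver: "version g R y = g y" if "y \<in> {0..1} - R" for y
    using regular_version_unique[OF sR version_props(2)[OF adm] regg _ that]
      version_props(1)[OF adm] same_map_sym by blast
  have "constant_slope g l"
    unfolding constant_slope_def
  proof (intro exI[of _ R] conjI ballI adm)
    fix J assume J: "J \<in> basic_intervals R"
    have "version g R y = g y" if "y \<in> J" for y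
      using ver basic_intervalD(1)[OF J] that by blast
    then show "\<exists>a b. \<bar>a\<bar> = l \<and> (\<forall>y\<in>J. version g R y = a * y + b)" using gaff[OF J] by simp
  qed
  moreover have "semiconjugates \<phi> f g"
    unfolding semiconjugates_def
  proof (intro conjI \<phi> exI[of _ Q] Q ballI)
    show "admissible g (\<phi> ` Q)" using adm unfolding R_def .
    fix I assume I: "I \<in> basic_intervals Q"
    obtain a b where ab: "\<bar>a\<bar> = l" "\<And>x. x \<in> I \<Longrightarrow> \<phi> (?f x) = a * \<phi> x + b"
      using affine[OF I] by blast
    have I01: "x \<in> {0..1}" "\<phi> (?f x) \<in> {0..1}" "\<phi> x \<in> {0..1}" if "x \<in> I" for x
    proof -
      have "x \<in> {0..1} - Q" using basic_intervalD(1)[OF I] that by blast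
      then have "x \<in> {0..1}" "?f x \<in> {0..1}" using reg unfolding regular_off_def by blast+
      then show "x \<in> {0..1}" "\<phi> (?f x) \<in> {0..1}" "\<phi> x \<in> {0..1}" using \<phi>01 by blast+
    qed
    show "\<exists>h. continuous_on (\<phi> ` I) h \<and> h ` \<phi> ` I \<subseteq> {0..1} \<and>
        (\<forall>x\<in>I. \<phi> (?f x) = h (\<phi> x)) \<and>
        (\<forall>y\<in>\<phi> ` I - \<phi> ` Q. h y = version g (\<phi> ` Q) y)"
    \<comment> \<open>The affine formula makes sense on all of the image of \<open>I\<close>,
      including points of \<open>R\<close> where the value of \<open>g\<close> is arbitrary.\<close>
    proof (intro exI[of _ "\<lambda>y. a * y + b"] conjI ballI)
      show "continuous_on (\<phi> ` I) (\<lambda>y. a * y + b)" by (intro continuous_intros)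
      show "(\<lambda>y. a * y + b) ` \<phi> ` I \<subseteq> {0..1}"
      proof clarify
        fix x assume x: "x \<in> I"
        show "a * \<phi> x + b \<in> {0..1}" using ab(2)[OF x] I01(2)[OF x] by simp
      qed
      show "\<phi> (?f x) = a * \<phi> x + b" if "x \<in> I" for x by (rule ab(2)[OF that])
      fix y assume "y \<in> \<phi> ` I - \<phi> ` Q"
      then obtain x where x: "x \<in> I" "y = \<phi> x" "\<phi> x \<notin> R" unfolding R_def by blast
      then have "version g R y = \<phi> (?f x)" using ver[of y] I01[OF x(1)] g by simp
      then show "a * y + b = version g (\<phi> ` Q) y" using ab(2)[OF x(1)] x(2) unfolding R_def by simp
    qed
  qed
  moreover have "g \<in> class_C" using adm unfolding class_C_def by blast
  ultimately show ?thesis by blast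
qed

lemma nonatomic_singleton:
  assumes "nonatomic M"
  shows "emeasure M {x} = 0"
proof (rule ccontr)
  assume ne: "emeasure M {x} \<noteq> 0"
  \<comment> \<open>Sets outside the sigma-algebra have \<open>emeasure\<close> 0 by convention, so
    a singleton of nonzero measure is measurable.\<close>
  then have "{x} \<in> sets M" using emeasure_notin_sets by blast
  then obtain B where B: "B \<subseteq> {x}" "0 < emeasure M B" "emeasure M B < emeasure M {x}"
    using assms ne unfolding nonatomic_def by (metis zero_less_iff_neq_zero)
  then have "B = {} \<or> B = {x}" by blast
  then show False using B(2,3) by auto
qed

text \<open>\<open>\<phi>\<close> is the distribution function of \<open>\<mu>\<close>. The
  eigenvalue equation on a compact interval inside one basic interval is exactly the increment
  identity required by \<open>constant_slope_factor\<close>.\<close>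

lemma semiconjugacy_of_measure:
  assumes f: "f \<in> class_C" and l: "l > 0" and prob: "prob_space \<mu>" and \<mu>: "\<mu> \<in> class_M"
    and eigen: "transfer f \<mu> = scale_measure (ennreal l) \<mu>"
  shows "\<exists>\<phi> g. g \<in> class_C \<and> constant_slope g l \<and> semiconjugates \<phi> f g"
proof -
  interpret prob_space \<mu> by (rule prob)
  let ?S = "sets (restrict_space borel {0..1::real})"
  have S: "A \<in> ?S \<longleftrightarrow> A \<in> sets borel \<and> A \<subseteq> {0..1}" for A
    by (simp add: sets_restrict_space_iff conj_commute)
  have sets_\<mu>: "sets \<mu> = ?S" using \<mu> unfolding class_M_def by blast
  have space_\<mu>: "space \<mu> = {0..1}"
    using sets_eq_imp_space_eq[OF sets_\<mu>] by (simp add: space_restrict_space)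
  have "nonatomic \<mu>" using \<mu> unfolding class_M_def by blast
  then have pt: "emeasure \<mu> {x} = 0" for x by (rule nonatomic_singleton)
  have "(\<lambda>x. x) \<in> restrict_space borel {0..1::real} \<rightarrow>\<^sub>M borel"
    by (intro measurable_restrict_space1) simp
  then have ident: "(\<lambda>x. x) \<in> \<mu> \<rightarrow>\<^sub>M borel"
    by (simp add: measurable_cong_sets[OF sets_\<mu> refl])
  \<comment> \<open>\<open>N\<close> is \<open>\<mu>\<close> carried over to the whole line, where
    \<open>cdf\<close> and its continuity criterion apply.\<close>
  define N where "N = distr \<mu> borel (\<lambda>x. x)"
  have eN: "emeasure N A = emeasure \<mu> (A \<inter> {0..1})" if "A \<in> sets borel" for A
    unfolding N_def using that by (simp add: emeasure_distr[OF ident] space_\<mu>)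
  interpret N: real_distribution N
    unfolding N_def by (rule real_distribution_distr[OF ident])
  have N0: "measure N {x} = 0" for x
  proof -
    have "{x} \<inter> {0..1} = {x} \<or> {x} \<inter> {0..1} = {}" by blast
    then have "emeasure N {x} = 0" using eN[of "{x}"] pt by auto
    then show ?thesis by (simp add: measure_def)
  qed
  define \<phi> where "\<phi> = cdf N"
  have cont: "continuous_on A \<phi>" for A
    unfolding \<phi>_def using N0 by (intro continuous_at_imp_continuous_on) (simp add: N.isCont_cdf)
  have mono: "mono_on A \<phi>" for A
    unfolding \<phi>_def by (intro mono_onI N.cdf_nondecreasing)
  have Icc: "emeasure \<mu> {x..y} = ennreal (\<phi> y - \<phi> x)" if "x \<in> {0..1}" "y \<in> {0..1}" "x \<le> y" for x y
  proof -
    have "measure N {x..y} = measure N ({x} \<union> {x<..y})"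
      using that(3) by (intro arg_cong[where f = "measure N"]) auto
    also have "\<dots> = measure N {x} + measure N {x<..y}"
      by (intro N.finite_measure_Union) auto
    also have "\<dots> = \<phi> y - \<phi> x"
      using N0 N.cdf_diff_eq[of x y] that(3) unfolding \<phi>_def by (cases "x = y") auto
    finally have "emeasure N {x..y} = ennreal (\<phi> y - \<phi> x)" by (simp add: N.emeasure_eq_measure)
    moreover have "{x..y} \<inter> {0..1} = {x..y}" using that by auto
    ultimately show ?thesis
      using eN[OF borel_closed[OF closed_atLeastAtMost], of x y] by metis
  qed
  have \<phi>0: "\<phi> 0 = 0"
  proof -
    have "{..0} \<inter> {0..1} = {0::real}" by auto
    then have "emeasure N {..0} = 0" using eN[of "{..0}"] pt by simp
    then show ?thesis unfolding \<phi>_def cdf_def by (simp add: measure_def)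
  qed
  have \<phi>1: "\<phi> 1 = 1"
  proof -
    have "{..1} \<inter> {0..1} = {0..1::real}" by auto
    then have "emeasure N {..1} = 1" using eN[of "{..1}"] emeasure_space_1 space_\<mu> by simp
    then show ?thesis unfolding \<phi>_def cdf_def by (simp add: measure_def)
  qed
  have surj: "\<phi> ` {0..1} = {0..1}"
  proof
    show "\<phi> ` {0..1} \<subseteq> {0..1}"
      using mono_onD[OF mono[of UNIV], of 0] mono_onD[OF mono[of UNIV], of _ 1] \<phi>0 \<phi>1
      by (simp add: image_subset_iff)
    have "connected (\<phi> ` {0..1})" using cont by (intro connected_continuous_image) auto
    then show "{0..1} \<subseteq> \<phi> ` {0..1}"
      using connected_contains_Icc[of "\<phi> ` {0..1}" 0 1] \<phi>0 \<phi>1 by force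
  qed
  define Q where "Q = (SOME P. admissible f P)"
  have Q: "admissible f Q"
    unfolding Q_def using f someI_ex[of "admissible f"] unfolding class_C_def by blast
  let ?f = "version f Q"
  note reg = version_props(2)[OF Q]
  let ?\<nu> = "\<lambda>A. \<Sum>\<^sub>\<infinity>I\<in>basic_intervals Q. emeasure \<mu> (?f ` (I \<inter> A))"
  have T: "transfer f \<mu> = measure_of {0..1} ?S ?\<nu>"
    unfolding transfer_def Q_def Let_def ..
  have sig: "sigma_sets {0..1} ?S = ?S"
    using sets.sigma_sets_eq[of "restrict_space borel {0..1::real}"] by (simp add: space_restrict_space)
  have "?S \<subseteq> Pow {0..1}" using S by blast
  then have emT: "emeasure (transfer f \<mu>) A = (if A \<in> ?S \<and> measure_space {0..1} ?S ?\<nu> then ?\<nu> A else 0)" for A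
    unfolding T using emeasure_measure_of_conv[of "{0..1}" ?S ?\<nu>] by (simp add: sig)
  have "emeasure (transfer f \<mu>) {0..1} = ennreal l"
    unfolding eigen using emeasure_space_1 space_\<mu> by simp
  \<comment> \<open>\<open>measure_of\<close> returns the zero measure when its set function is not countably additive,
    and \<open>l \<mu>\<close> is not zero; so countable additivity of \<open>?\<nu>\<close> need not be checked.\<close>
  then have ms: "measure_space {0..1} ?S ?\<nu>" using emT l by (metis ennreal_eq_0_iff not_less)
  have key: "?\<nu> A = ennreal l * emeasure \<mu> A" if "A \<in> ?S" for A
    using emT[of A] ms that unfolding eigen by simp
  have incr_le: "\<bar>\<phi> (?f y) - \<phi> (?f x)\<bar> = l * \<bar>\<phi> y - \<phi> x\<bar>"
    if I: "I \<in> basic_intervals Q" and xy: "x \<in> I" "y \<in> I" "x \<le> y" for I x y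
  proof -
    note im = basic_interval_image_Icc[OF reg I xy]
    have xy01: "x \<in> {0..1}" "y \<in> {0..1}" using basic_intervalD(1)[OF I] xy by blast+
    \<comment> \<open>Other basic intervals are disjoint from \<open>I\<close>, hence from [x,y], so
      only one term of the sum survives.\<close>
    have "?\<nu> {x..y} = (\<Sum>\<^sub>\<infinity>K\<in>{I}. emeasure \<mu> (?f ` (K \<inter> {x..y})))"
    proof (rule infsum_cong_neutral)
      fix K assume "K \<in> basic_intervals Q - {I}"
      then have "K \<inter> I = {}" using disjoint_basic_intervals I unfolding disjoint_def by blast
      then have "K \<inter> {x..y} = {}" using im(1) by blast
      then show "emeasure \<mu> (?f ` (K \<inter> {x..y})) = 0" by simp
    qed (use I in auto)
    also have "\<dots> = emeasure \<mu> (?f ` {x..y})" using im(1) by (simp add: Int_absorb1)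
    also have "\<dots> = ennreal (\<phi> (max (?f x) (?f y)) - \<phi> (min (?f x) (?f y)))"
      unfolding im(2) using Icc[OF im(3,4)] by simp
    also have "\<phi> (max (?f x) (?f y)) - \<phi> (min (?f x) (?f y)) = \<bar>\<phi> (?f y) - \<phi> (?f x)\<bar>"
      using mono_onD[OF mono im(3,4)] by (auto simp: max_def min_def)
    finally have "ennreal \<bar>\<phi> (?f y) - \<phi> (?f x)\<bar> = ennreal l * emeasure \<mu> {x..y}"
      using key[of "{x..y}"] S[of "{x..y}"] xy01 by auto
    also have "\<dots> = ennreal (l * \<bar>\<phi> y - \<phi> x\<bar>)"
      using Icc[OF xy01 xy(3)] mono_onD[OF mono xy01 xy(3)] l by (simp add: ennreal_mult)
    finally show ?thesis using l by simp
  qed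
  have incr: "\<bar>\<phi> (?f y) - \<phi> (?f x)\<bar> = l * \<bar>\<phi> y - \<phi> x\<bar>"
    if "I \<in> basic_intervals Q" "x \<in> I" "y \<in> I" for I x y
    using incr_le[OF that] incr_le[OF that(1,3,2)] by (cases "x \<le> y") (auto simp: abs_minus_commute)
  have "\<exists>g. g \<in> class_C \<and> constant_slope g l \<and> semiconjugates \<phi> f g"
    using cont mono surj Q l incr by (rule constant_slope_factor)
  then show ?thesis by blast
qed

theorem theorem3p3:
  fixes f :: "real \<Rightarrow> real" and lam :: real
  assumes "f \<in> class_C" and "lam > 0"
  shows "(\<exists>\<phi> g. g \<in> class_C \<and> constant_slope g lam \<and> semiconjugates \<phi> f g)
     \<longleftrightarrow> (\<exists>\<mu>. prob_space \<mu> \<and> \<mu> \<in> class_M \<and> transfer f \<mu> = scale_measure (ennreal lam) \<mu>)"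
  using measure_of_semiconjugacy[OF assms(1) _ _ assms(2)] semiconjugacy_of_measure[OF assms] by blast

end
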